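(* Let $I$ and $J$ be ideals of $\mathcal O_n$ such that $I$ and $J$ are bi-Lipschitz equivalent. Then $\operatorname{ord}(I)=\operatorname{ord}(J)$. Moreover, if $I$ and $J$ have finite colength, then $\mathcal L_0(I)=\mathcal L_0(J)$.
   Context: $\mathcal O_n$ is the ring of complex analytic function germs $(\mathbb C^n,0)\to\mathbb C$ with maximal ideal $\mathfrak m_n$; ideals are understood to be proper; $\overline I$ denotes integral closure. $\operatorname{ord}(I)$ is the maximum of those $r$ such that $I\subseteq\mathfrak m_n^r$. For real function germs at $0$, $a(x)\lesssim b(x)$ near $0$ means there are $C>0$ and an open neighbourhood $U$ of $0$ with $a(x)\leq C\,b(x)$ on $U$; $a\sim b$ means $a\lesssim b$ and $b\lesssim a$. If $I$ has finite colength and is generated by the components of $f=(f_1,\dots,f_p)$, then $\mathcal L_0(I)=\inf\{\alpha\in\mathbb R_{\geq0}:\|x\|^\alpha\lesssim\|f(x)\|\text{ near }0\}$. A homeomorphism $\varphi:(\mathbb C^n,0)\to(\mathbb C^n,0)$ is bi-Lipschitz if $\varphi$ and $\varphi^{-1}$ are Lipschitz near $0$. Ideals $I$ and $J$ of $\mathcal O_n$ are bi-Lipschitz equivalent if there exist $f_1,\dots,f_p$ and $g_1,\dots,g_q$ in $\mathcal O_n$ such that: (a) $\langle f_1,\dots,f_p\rangle\subseteq I$ and $\overline{\langle f_1,\dots,f_p\rangle}=\overline I$; (b) $\langle g_1,\dots,g_q\rangle\subseteq J$ and $\overline{\langle g_1,\dots,g_q\rangle}=\overline J$; (c) there is a bi-Lipschitz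 homeomorphism $\varphi:(\mathbb C^n,0)\to(\mathbb C^n,0)$ such that $\|(f_1(x),\dots,f_p(x))\|\sim\|(g_1(\varphi(x)),\dots,g_q(\varphi(x)))\|$ near $0$. *)

theory Defs
  imports "HOL-Analysis.Analysis" "HOL-Library.Extended_Nat"
begin

section \<open>Ideals of a commutative ring\<close>

text \<open>A ring is regarded as a module over itself: its ideals are the submodules, and the ideal
  generated by a set is its span.\<close>

lemma module_mult: "module ((*) :: 'a::comm_ring_1 \<Rightarrow> 'a \<Rightarrow> 'a)"
  by standard (simp_all add: algebra_simps)

abbreviation is_ideal :: "'a::comm_ring_1 set \<Rightarrow> bool" where
  "is_ideal \<equiv> module.subspace (*)"

abbreviation ideal_gen :: "'a::comm_ring_1 set \<Rightarrow> 'a set" where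
  "ideal_gen \<equiv> module.span (*)"

definition proper_ideal :: "'a::comm_ring_1 set \<Rightarrow> bool" where
  "proper_ideal I \<longleftrightarrow> is_ideal I \<and> I \<noteq> UNIV"

fun ideal_power :: "'a::comm_ring_1 set \<Rightarrow> nat \<Rightarrow> 'a set" where
  "ideal_power I 0 = UNIV"
| "ideal_power I (Suc r) = ideal_gen {a * b |a b. a \<in> I \<and> b \<in> ideal_power I r}"

definition integral_closure :: "'a::comm_ring_1 set \<Rightarrow> 'a set" where
  "integral_closure I =
    {h. \<exists>k\<ge>1. \<exists>a. (\<forall>i\<in>{1..k}. a i \<in> ideal_power I i) \<and> h ^ k + (\<Sum>i=1..k. a i * h ^ (k - i)) = 0}"

section \<open>Germs of complex analytic functions\<close>

definition monomial :: "('n::finite \<Rightarrow> nat) \<Rightarrow> complex ^ 'n \<Rightarrow> complex" where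
  "monomial \<alpha> x = (\<Prod>i\<in>UNIV. x $ i ^ \<alpha> i)"

text \<open>Multi-indices are functions \<open>'n \<Rightarrow> nat\<close>. Summation is unconditional, i.e. absolute.\<close>

definition analytic_at_0 :: "(complex ^ 'n::finite \<Rightarrow> complex) \<Rightarrow> bool" where
  "analytic_at_0 f \<longleftrightarrow>
    (\<exists>c. \<exists>r>0. \<forall>x. norm x < r \<longrightarrow> ((\<lambda>\<alpha>. c \<alpha> * monomial \<alpha> x) has_sum f x) UNIV)"

lemma analytic_at_0_const: "analytic_at_0 (\<lambda>_. a)"
  unfolding analytic_at_0_def
proof (intro exI conjI allI impI)
  fix x :: "complex ^ 'n"
  show "((\<lambda>\<alpha>. (if \<alpha> = (\<lambda>_. 0) then a else 0) * monomial \<alpha> x) has_sum a) UNIV"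
    by (rule has_sum_finite_neutralI[where B = "{\<lambda>_. 0}"]) (auto simp: monomial_def)
qed (rule zero_less_one)

lemma analytic_at_0_add:
  assumes "analytic_at_0 f" "analytic_at_0 g"
  shows "analytic_at_0 (\<lambda>x. f x + g x)"
proof -
  obtain c r where c: "r > 0" "\<And>x. norm x < r \<Longrightarrow> ((\<lambda>\<alpha>. c \<alpha> * monomial \<alpha> x) has_sum f x) UNIV"
    using assms(1) unfolding analytic_at_0_def by blast
  obtain d s where d: "s > 0" "\<And>x. norm x < s \<Longrightarrow> ((\<lambda>\<alpha>. d \<alpha> * monomial \<alpha> x) has_sum g x) UNIV"
    using assms(2) unfolding analytic_at_0_def by blast
  have "((\<lambda>\<alpha>. (c \<alpha> + d \<alpha>) * monomial \<alpha> x) has_sum (f x + g x)) UNIV" if "norm x < min r s" for x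
    using has_sum_add[OF c(2) d(2)] that by (simp add: algebra_simps)
  then show ?thesis
    unfolding analytic_at_0_def using c(1) d(1) by (meson min_less_iff_conj)
qed

lemma finite_multiindex_le: "finite {\<alpha>::'n::finite \<Rightarrow> nat. \<alpha> \<le> \<gamma>}"
proof -
  have "{\<alpha>. \<alpha> \<le> \<gamma>} = (\<Pi>\<^sub>E i\<in>UNIV. {..\<gamma> i})"
    by (auto simp: le_fun_def PiE_def)
  then show ?thesis
    by (simp add: finite_PiE)
qed

lemma has_sum_times:
  fixes F :: "'a \<Rightarrow> complex" and G :: "'b \<Rightarrow> complex"
  assumes F: "(F has_sum S) A" and G: "(G has_sum T) B"
  shows "((\<lambda>(x, y). F x * G y) has_sum (S * T)) (A \<times> B)"
proof (rule has_sum_SigmaI[where g = "\<lambda>x. F x * T"])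
  show "(\<lambda>(x, y). F x * G y) summable_on A \<times> B"
  proof (rule abs_summable_summable)
    have "(\<lambda>x. norm (F x)) summable_on A" "(\<lambda>y. norm (G y)) summable_on B"
      using F[THEN has_sum_imp_summable] G[THEN has_sum_imp_summable]
      by (simp_all only: summable_on_iff_abs_summable_on_complex)
    then show "(\<lambda>p. norm (case p of (x, y) \<Rightarrow> F x * G y)) summable_on A \<times> B"
      by (subst Infinite_Sum.abs_summable_on_Sigma_iff)
        (simp add: norm_mult infsum_cmult_right' abs_mult infsum_nonneg
          summable_on_cmult_left summable_on_cmult_right)
  qed
qed (use F G in \<open>auto intro: has_sum_cmult_right has_sum_cmult_left\<close>)

lemma analytic_at_0_mult:
  fixes f g :: "complex ^ 'n::finite \<Rightarrow> complex"
  assumes "analytic_at_0 f" "analytic_at_0 g"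
  shows "analytic_at_0 (\<lambda>x. f x * g x)"
proof -
  obtain c r where c: "r > 0" "\<And>x. norm x < r \<Longrightarrow> ((\<lambda>\<alpha>. c \<alpha> * monomial \<alpha> x) has_sum f x) UNIV"
    using assms(1) unfolding analytic_at_0_def by blast
  obtain d s where d: "s > 0" "\<And>x. norm x < s \<Longrightarrow> ((\<lambda>\<alpha>. d \<alpha> * monomial \<alpha> x) has_sum g x) UNIV"
    using assms(2) unfolding analytic_at_0_def by blast
  have "((\<lambda>\<gamma>. (\<Sum>\<alpha>\<in>{\<alpha>. \<alpha> \<le> \<gamma>}. c \<alpha> * d (\<lambda>i. \<gamma> i - \<alpha> i)) * monomial \<gamma> x) has_sum (f x * g x)) UNIV"
    if x: "norm x < min r s" for x
  proof -
    let ?F = "\<lambda>\<alpha>. c \<alpha> * monomial \<alpha> x" and ?G = "\<lambda>\<beta>. d \<beta> * monomial \<beta> x"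
    have F: "(?F has_sum f x) UNIV" and G: "(?G has_sum g x) UNIV"
      using c d x by auto
    have "((\<lambda>(\<alpha>, \<beta>). ?F \<alpha> * ?G \<beta>) has_sum (f x * g x)) (UNIV \<times> UNIV)"
      using F G by (rule has_sum_times)
    also have "?this \<longleftrightarrow> ((\<lambda>(\<gamma>, \<alpha>). ?F \<alpha> * ?G (\<lambda>i. \<gamma> i - \<alpha> i)) has_sum (f x * g x))
        (SIGMA \<gamma>:UNIV. {\<alpha>. \<alpha> \<le> \<gamma>})"
      by (rule has_sum_reindex_bij_witness[where
            i = "\<lambda>(\<gamma>, \<alpha>). (\<alpha>, \<lambda>i. \<gamma> i - \<alpha> i)" and j = "\<lambda>(\<alpha>, \<beta>). (\<lambda>i. \<alpha> i + \<beta> i, \<alpha>)"])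
        (auto simp: le_fun_def)
    finally have "((\<lambda>\<gamma>. \<Sum>\<alpha>\<in>{\<alpha>. \<alpha> \<le> \<gamma>}. ?F \<alpha> * ?G (\<lambda>i. \<gamma> i - \<alpha> i)) has_sum (f x * g x)) UNIV"
      by (auto elim!: has_sum_SigmaD intro!: has_sum_finite finite_multiindex_le)
    also have "(\<lambda>\<gamma>. \<Sum>\<alpha>\<in>{\<alpha>. \<alpha> \<le> \<gamma>}. ?F \<alpha> * ?G (\<lambda>i. \<gamma> i - \<alpha> i)) =
        (\<lambda>\<gamma>. (\<Sum>\<alpha>\<in>{\<alpha>. \<alpha> \<le> \<gamma>}. c \<alpha> * d (\<lambda>i. \<gamma> i - \<alpha> i)) * monomial \<gamma> x)"
    proof (unfold sum_distrib_right, intro ext sum.cong refl)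
      fix \<alpha> \<gamma> :: "'n \<Rightarrow> nat" assume "\<alpha> \<in> {\<alpha>. \<alpha> \<le> \<gamma>}"
      then have "monomial \<gamma> x = monomial \<alpha> x * monomial (\<lambda>i. \<gamma> i - \<alpha> i) x"
        by (simp add: monomial_def le_fun_def flip: prod.distrib power_add)
      then show "?F \<alpha> * ?G (\<lambda>i. \<gamma> i - \<alpha> i) = c \<alpha> * d (\<lambda>i. \<gamma> i - \<alpha> i) * monomial \<gamma> x"
        by simp
    qed
    finally show ?thesis .
  qed
  then show ?thesis
    unfolding analytic_at_0_def using c(1) d(1) by (meson min_less_iff_conj)
qed

lemma analytic_at_0_uminus:
  assumes "analytic_at_0 f"
  shows "analytic_at_0 (\<lambda>x. - f x)"
  using analytic_at_0_mult[OF analytic_at_0_const[of "-1"] assms] by simp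

text \<open>\<open>'n germ\<close> is the ring of germs in \<open>CARD('n)\<close> variables.\<close>

quotient_type 'n germ = "complex ^ 'n::finite \<Rightarrow> complex" / partial:
  "\<lambda>f g. analytic_at_0 f \<and> analytic_at_0 g \<and> (\<forall>\<^sub>F x in nhds 0. f x = g x)"
proof (rule part_equivpI)
  show "\<exists>f :: complex ^ 'n \<Rightarrow> complex.
      analytic_at_0 f \<and> analytic_at_0 f \<and> (\<forall>\<^sub>F x in nhds 0. f x = f x)"
    using analytic_at_0_const by auto
next
  show "symp (\<lambda>f g :: complex ^ 'n \<Rightarrow> complex.
      analytic_at_0 f \<and> analytic_at_0 g \<and> (\<forall>\<^sub>F x in nhds 0. f x = g x))"
    by (rule sympI) (simp add: eq_commute)
next
  show "transp (\<lambda>f g :: complex ^ 'n \<Rightarrow> complex.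
      analytic_at_0 f \<and> analytic_at_0 g \<and> (\<forall>\<^sub>F x in nhds 0. f x = g x))"
    by (rule transpI) (auto elim: eventually_elim2[where R = "\<lambda>x. _ x = _ x"])
qed

instantiation germ :: (finite) comm_ring_1
begin

lift_definition zero_germ :: "'a germ" is "\<lambda>_. 0"
  by (simp add: analytic_at_0_const)

lift_definition one_germ :: "'a germ" is "\<lambda>_. 1"
  by (simp add: analytic_at_0_const)

lift_definition plus_germ :: "'a germ \<Rightarrow> 'a germ \<Rightarrow> 'a germ" is "\<lambda>f g x. f x + g x"
  by (auto intro: analytic_at_0_add elim: eventually_elim2)

lift_definition uminus_germ :: "'a germ \<Rightarrow> 'a germ" is "\<lambda>f x. - f x"
  by (auto intro: analytic_at_0_uminus elim: eventually_mono)

lift_definition times_germ :: "'a germ \<Rightarrow> 'a germ \<Rightarrow> 'a germ" is "\<lambda>f g x. f x * g x"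
  by (auto intro: analytic_at_0_mult elim: eventually_elim2)

definition minus_germ :: "'a germ \<Rightarrow> 'a germ \<Rightarrow> 'a germ" where
  "minus_germ f g = f + - g"

instance
proof
  show "(0 :: 'a germ) \<noteq> 1"
    by transfer (simp add: eventually_False)
  fix f g h :: "'a germ"
  show "f * g * h = f * (g * h)"
    by transfer (simp add: analytic_at_0_mult mult.assoc)
  show "f * g = g * f"
    by transfer (simp add: analytic_at_0_mult mult.commute)
  show "1 * f = f"
    by transfer simp
  show "f + g + h = f + (g + h)"
    by transfer (simp add: analytic_at_0_add add.assoc)
  show "f + g = g + f"
    by transfer (simp add: analytic_at_0_add add.commute)
  show "0 + f = f"
    by transfer simp
  show "- f + f = 0"
    by transfer (simp add: analytic_at_0_const)
  show "f - g = f + - g"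
    by (rule minus_germ_def)
  show "(f + g) * h = f * h + g * h"
    by transfer (simp add: analytic_at_0_add analytic_at_0_mult distrib_right)
qed

end

lift_definition const_germ :: "complex \<Rightarrow> 'n::finite germ" is "\<lambda>c _. c"
  by (simp add: analytic_at_0_const)

text \<open>\<open>rep_germ\<close> chooses a function representing a germ. Everything below depends only on the
  behaviour of that function near 0, hence not on the choice.\<close>

lemma rep_germ_abs_germ:
  assumes "analytic_at_0 f"
  shows "\<forall>\<^sub>F x in nhds 0. rep_germ (abs_germ f) x = f x"
  using Quotient3_rep_abs[OF Quotient3_germ, of f] assms by simp

lemma analytic_at_0_rep_germ: "analytic_at_0 (rep_germ f)"
  using Quotient3_rep_reflp[OF Quotient3_germ, of f] by simp

definition max_ideal :: "'n::finite germ set" where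
  "max_ideal = {f. rep_germ f 0 = 0}"

text \<open>The zero ideal lies in every power of the maximal ideal; it gets order \<open>\<infinity>\<close>. For every other
  ideal the supremum is a maximum.\<close>

definition ideal_order :: "'n::finite germ set \<Rightarrow> enat" where
  "ideal_order I = Sup (enat ` {r. I \<subseteq> ideal_power max_ideal r})"

global_interpretation germ_vector_space: vector_space "\<lambda>c f. const_germ c * (f :: 'n::finite germ)"
proof
  fix a b :: complex and f g :: "'n germ"
  show "const_germ (a + b) * f = const_germ a * f + const_germ b * f"
    by transfer (auto simp: algebra_simps
        intro!: analytic_at_0_add analytic_at_0_mult analytic_at_0_const)
  show "const_germ a * (const_germ b * f) = const_germ (a * b) * f"
    by transfer (auto simp: algebra_simps intro!: analytic_at_0_mult analytic_at_0_const)
  show "const_germ 1 * f = f"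
    by transfer auto
qed (simp add: algebra_simps)

text \<open>The quotient by \<open>I\<close> is a finite-dimensional complex vector space.\<close>

definition finite_colength :: "'n::finite germ set \<Rightarrow> bool" where
  "finite_colength I \<longleftrightarrow> (\<exists>B. finite B \<and> (\<forall>f. \<exists>g\<in>germ_vector_space.span B. f - g \<in> I))"

section \<open>Comparison of function germs at 0 and the Lojasiewicz exponent\<close>

definition lesssim_at_0 :: "('a::real_normed_vector \<Rightarrow> real) \<Rightarrow> ('a \<Rightarrow> real) \<Rightarrow> bool" where
  "lesssim_at_0 a b \<longleftrightarrow> (\<exists>C>0. \<exists>U. open U \<and> 0 \<in> U \<and> (\<forall>x\<in>U. a x \<le> C * b x))"

definition sim_at_0 :: "('a::real_normed_vector \<Rightarrow> real) \<Rightarrow> ('a \<Rightarrow> real) \<Rightarrow> bool" where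
  "sim_at_0 a b \<longleftrightarrow> lesssim_at_0 a b \<and> lesssim_at_0 b a"

definition tuple_norm :: "'n::finite germ list \<Rightarrow> complex ^ 'n \<Rightarrow> real" where
  "tuple_norm fs x = L2_set (\<lambda>i. norm (rep_germ (fs ! i) x)) {..<length fs}"

text \<open>In HOL \<open>0 powr 0 = 0\<close>. This is harmless: for \<open>\<alpha> = 0\<close> the estimate at the points \<open>x \<noteq> 0\<close> implies
  \<open>1 \<le> C * tuple_norm fs 0\<close> by continuity.\<close>

definition lojasiewicz_tuple :: "'n::finite germ list \<Rightarrow> real" where
  "lojasiewicz_tuple fs = Inf {\<alpha>. \<alpha> \<ge> 0 \<and> lesssim_at_0 (\<lambda>x. norm x powr \<alpha>) (tuple_norm fs)}"

text \<open>The exponent of an ideal does not depend on the finite generating tuple.\<close>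

definition lojasiewicz :: "'n::finite germ set \<Rightarrow> real" where
  "lojasiewicz I = (THE l. \<exists>fs. ideal_gen (set fs) = I \<and> l = lojasiewicz_tuple fs)"

section \<open>Bi-Lipschitz equivalence\<close>

definition bilipschitz_homeo_germ :: "('a::real_normed_vector \<Rightarrow> 'a) \<Rightarrow> bool" where
  "bilipschitz_homeo_germ \<phi> \<longleftrightarrow> \<phi> 0 = 0 \<and>
    (\<exists>U V \<psi>. open U \<and> 0 \<in> U \<and> open V \<and> 0 \<in> V \<and> homeomorphism U V \<phi> \<psi> \<and>
      (\<exists>C U'. open U' \<and> 0 \<in> U' \<and> U' \<subseteq> U \<and> C-lipschitz_on U' \<phi>) \<and>
      (\<exists>D V'. open V' \<and> 0 \<in> V' \<and> V' \<subseteq> V \<and> D-lipschitz_on V' \<psi>))"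

definition bilipschitz_equivalent :: "'n::finite germ set \<Rightarrow> 'n germ set \<Rightarrow> bool" where
  "bilipschitz_equivalent I J \<longleftrightarrow>
    (\<exists>fs gs.
      ideal_gen (set fs) \<subseteq> I \<and> integral_closure (ideal_gen (set fs)) = integral_closure I \<and>
      ideal_gen (set gs) \<subseteq> J \<and> integral_closure (ideal_gen (set gs)) = integral_closure J \<and>
      (\<exists>\<phi>. bilipschitz_homeo_germ \<phi> \<and> sim_at_0 (tuple_norm fs) (\<lambda>x. tuple_norm gs (\<phi> x))))"

end

theory Submission
  imports Defs "HOL-Computational_Algebra.Fundamental_Theorem_Algebra"
begin

text \<open>Both invariants compare the norm of a generating tuple with powers of \<open>norm x\<close>, and such
  comparisons are insensitive to the two operations that make up bi-Lipschitz equivalence.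

  Passing to a reduction: an element \<open>h\<close> of the integral closure of \<open>\<langle>f\<^sub>1, \<dots>, f\<^sub>p\<rangle>\<close> satisfies an
  equation whose \<open>i\<close>-th coefficient is bounded by a multiple of \<open>\<parallel>f\<parallel> ^ i\<close>; the usual bound for the
  roots of a polynomial in terms of its coefficients then gives \<open>\<bar>h\<bar> \<lesssim> \<parallel>f\<parallel>\<close>
  (\<open>dominated_integral_closure\<close>). Hence all elements of \<open>I\<close> are bounded by the norm of a tuple that
  generates a reduction of \<open>I\<close>.

  Changing coordinates: a bi-Lipschitz homeomorphism \<open>\<phi>\<close> satisfies \<open>norm (\<phi> x) \<sim> norm x\<close>, so it
  turns a comparison with a power of \<open>norm x\<close> into the same comparison
  (\<open>bilipschitz_compare_norm\<close>).

  For the order, the link between algebra and growth is that \<open>f\<close> lies in the \<open>r\<close>-th power of the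
  maximal ideal iff \<open>\<bar>f x\<bar> \<lesssim> norm x ^ r\<close> (\<open>power_max_ideal_iff\<close>). The growth condition kills
  the homogeneous parts of \<open>f\<close> of degree less than \<open>r\<close> one after the other, and a power series
  without terms of degree less than \<open>r\<close> is a combination of the monomials of degree \<open>r\<close> with
  analytic coefficients (\<open>ideal_gen_monomials\<close>).

  For the Lojasiewicz exponent, two tuples with equivalent norms have the same exponent, so that of
  \<open>I\<close> is that of any tuple generating a reduction, as soon as \<open>I\<close> is generated by some tuple at all.
  For an ideal of finite colength this is proved directly
  (\<open>finite_colength_imp_finitely_generated\<close>): the powers of a coordinate are linearly dependent
  modulo \<open>I\<close>, so \<open>I\<close> contains a polynomial in this coordinate, which is a unit times a power of the
  coordinate. Modulo the resulting powers, every germ is a polynomial of bounded degree, and the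
  polynomials of bounded degree in \<open>I\<close> form a finite-dimensional space.\<close>

interpretation ideal: module "(*) :: 'a::comm_ring_1 \<Rightarrow> 'a \<Rightarrow> 'a"
  by (rule module_mult)

section \<open>Ring operations on germs and on their representatives\<close>

lemma rep_germ_plus: "\<forall>\<^sub>F x in nhds 0. rep_germ (f + g) x = rep_germ f x + rep_germ g x"
  unfolding plus_germ_def
  by (simp add: rep_germ_abs_germ analytic_at_0_add analytic_at_0_rep_germ)

lemma rep_germ_times: "\<forall>\<^sub>F x in nhds 0. rep_germ (f * g) x = rep_germ f x * rep_germ g x"
  unfolding times_germ_def
  by (simp add: rep_germ_abs_germ analytic_at_0_mult analytic_at_0_rep_germ)

lemma rep_germ_const: "\<forall>\<^sub>F x in nhds 0. rep_germ (const_germ c) x = c"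
  unfolding const_germ_def
  by (simp add: rep_germ_abs_germ analytic_at_0_const)

lemma rep_germ_zero: "\<forall>\<^sub>F x in nhds 0. rep_germ 0 x = 0"
  unfolding zero_germ_def by (simp add: rep_germ_abs_germ analytic_at_0_const)

lemma rep_germ_one: "\<forall>\<^sub>F x in nhds 0. rep_germ 1 x = 1"
  unfolding one_germ_def by (simp add: rep_germ_abs_germ analytic_at_0_const)

lemma germ_eqI: "\<forall>\<^sub>F x in nhds 0. rep_germ f x = rep_germ g x \<Longrightarrow> f = g"
  using Quotient3_rel_rep[OF Quotient3_germ, of f g] by (simp add: analytic_at_0_rep_germ)

lemma rep_germ_sum:
  "\<forall>\<^sub>F x in nhds 0. rep_germ (\<Sum>i\<in>A. f i) x = (\<Sum>i\<in>A. rep_germ (f i) x)"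
proof (induction A rule: infinite_finite_induct)
  case (insert a A)
  from rep_germ_plus[of "f a" "sum f A"] insert.IH show ?case
    by eventually_elim (simp add: insert.hyps)
qed (simp_all add: rep_germ_zero)

lemma rep_germ_power: "\<forall>\<^sub>F x in nhds 0. rep_germ (f ^ k) x = rep_germ f x ^ k"
proof (induction k)
  case (Suc k)
  from rep_germ_times[of f "f ^ k"] Suc show ?case
    by eventually_elim simp
qed (simp add: rep_germ_one)

lemma const_germ_algebra:
  "const_germ 0 = 0" "const_germ 1 = 1" "const_germ (a + b) = const_germ a + const_germ b"
  "const_germ (a * b) = const_germ a * const_germ b" "const_germ (- a) = - const_germ a"
  by (transfer; simp add: analytic_at_0_const)+

section \<open>Power series of germs\<close>

definition has_series :: "'n::finite germ \<Rightarrow> (('n \<Rightarrow> nat) \<Rightarrow> complex) \<Rightarrow> bool" where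
  "has_series f c \<longleftrightarrow>
    (\<forall>\<^sub>F x in nhds 0. ((\<lambda>\<alpha>. c \<alpha> * monomial \<alpha> x) has_sum rep_germ f x) UNIV)"

lemma eventually_nhds_0_norm:
  "(\<forall>\<^sub>F x in nhds (0::'a::real_normed_vector). P x) \<longleftrightarrow> (\<exists>r>0. \<forall>x. norm x < r \<longrightarrow> P x)"
  by (simp add: eventually_nhds_metric dist_norm)

lemma has_series_exists: "\<exists>c. has_series f c"
  using analytic_at_0_rep_germ[of f]
  unfolding analytic_at_0_def has_series_def eventually_nhds_0_norm .

lemma has_series_unique: "has_series f c \<Longrightarrow> has_series g c \<Longrightarrow> f = g"
  unfolding has_series_def
  by (rule germ_eqI, erule (1) eventually_elim2, rule has_sum_unique)

lemma has_series_plus: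
  assumes "has_series f c" "has_series g d"
  shows "has_series (f + g) (\<lambda>\<alpha>. c \<alpha> + d \<alpha>)"
  using rep_germ_plus[of f g] assms unfolding has_series_def
  by eventually_elim (simp add: has_sum_add distrib_right)

lemma has_series_iff_summable:
  "(\<exists>f. has_series f c) \<longleftrightarrow> (\<forall>\<^sub>F x in nhds 0. (\<lambda>\<alpha>. c \<alpha> * monomial \<alpha> x) summable_on UNIV)"
proof
  show "\<forall>\<^sub>F x in nhds 0. (\<lambda>\<alpha>. c \<alpha> * monomial \<alpha> x) summable_on UNIV" if "\<exists>f. has_series f c"
    using that unfolding has_series_def
    by (auto elim!: eventually_mono intro: has_sum_imp_summable)
next
  let ?f = "\<lambda>x. \<Sum>\<^sub>\<infinity>\<alpha>. c \<alpha> * monomial \<alpha> x"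
  assume *: "\<forall>\<^sub>F x in nhds 0. (\<lambda>\<alpha>. c \<alpha> * monomial \<alpha> x) summable_on UNIV"
  then have sum: "\<forall>\<^sub>F x in nhds 0. ((\<lambda>\<alpha>. c \<alpha> * monomial \<alpha> x) has_sum ?f x) UNIV"
    by (rule eventually_mono) (rule has_sum_infsum)
  then have "analytic_at_0 ?f"
    unfolding analytic_at_0_def eventually_nhds_0_norm by blast
  then have "\<forall>\<^sub>F x in nhds 0. rep_germ (abs_germ ?f) x = ?f x"
    by (rule rep_germ_abs_germ)
  with sum have "has_series (abs_germ ?f) c"
    unfolding has_series_def by eventually_elim simp
  then show "\<exists>f. has_series f c" ..
qed

lemma norm_monomial_le:
  assumes "norm x \<le> \<epsilon>"
  shows "norm (monomial \<alpha> x) \<le> \<epsilon> ^ sum \<alpha> UNIV"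
proof -
  have "norm (x $ i) \<le> \<epsilon>" for i
    using Finite_Cartesian_Product.norm_nth_le[of x i] assms by simp
  then have "(\<Prod>i\<in>UNIV. norm (x $ i) ^ \<alpha> i) \<le> (\<Prod>i\<in>UNIV. \<epsilon> ^ \<alpha> i)"
    by (intro prod_mono conjI power_mono zero_le_power norm_ge_zero)
  then show ?thesis
    by (simp add: monomial_def prod_norm norm_power power_sum flip: prod_norm)
qed

text \<open>Evaluating at the point with all coordinates \<open>\<epsilon>\<close> bounds all terms on the ball of radius \<open>\<epsilon>\<close>
  at once. In this form convergence depends on the absolute values of the coefficients only, and
  omitting or shifting coefficients visibly preserves it.\<close>

lemma convergent_iff_polydisc:
  "(\<exists>f. has_series f c) \<longleftrightarrow> (\<exists>\<epsilon>>0. (\<lambda>\<alpha>. norm (c \<alpha>) * \<epsilon> ^ sum \<alpha> UNIV) summable_on UNIV)"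
    (is "?l \<longleftrightarrow> ?r") for c :: "('n::finite \<Rightarrow> nat) \<Rightarrow> complex"
proof
  assume ?l
  then obtain r where r: "r > 0"
    "\<And>x. norm x < r \<Longrightarrow> (\<lambda>\<alpha>. c \<alpha> * monomial \<alpha> x) summable_on UNIV"
    unfolding has_series_iff_summable eventually_nhds_0_norm by blast
  \<comment> \<open>The norm of the point \<open>(\<epsilon>, \<dots>, \<epsilon>)\<close> is at most \<open>CARD('n) * \<epsilon>\<close>, which has to be less than \<open>r\<close>.\<close>
  define \<epsilon> where "\<epsilon> = r / (2 * CARD('n))"
  define y :: "complex ^ 'n" where "y = (\<chi> i. of_real \<epsilon>)"
  have \<epsilon>: "\<epsilon> > 0"
    using r(1) by (simp add: \<epsilon>_def)
  have "norm y \<le> (\<Sum>i\<in>UNIV. norm (y $ i))"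
    unfolding norm_vec_def by (rule L2_set_le_sum) simp
  also have "\<dots> = r / 2"
    using \<epsilon> by (simp add: y_def) (simp add: \<epsilon>_def)
  finally have "(\<lambda>\<alpha>. c \<alpha> * monomial \<alpha> y) summable_on UNIV"
    using r by simp
  then have "(\<lambda>\<alpha>. norm (c \<alpha> * monomial \<alpha> y)) summable_on UNIV"
    by (simp only: summable_on_iff_abs_summable_on_complex)
  also have "(\<lambda>\<alpha>. norm (c \<alpha> * monomial \<alpha> y)) = (\<lambda>\<alpha>. norm (c \<alpha>) * \<epsilon> ^ sum \<alpha> UNIV)"
    using \<epsilon> by (simp add: monomial_def y_def norm_mult norm_power power_sum flip: prod_norm)
  finally show ?r
    using \<epsilon> by blast
next
  assume ?r
  then obtain \<epsilon> where \<epsilon>: "\<epsilon> > 0" "(\<lambda>\<alpha>. norm (c \<alpha>) * \<epsilon> ^ sum \<alpha> UNIV) summable_on UNIV"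
    by blast
  have "(\<lambda>\<alpha>. c \<alpha> * monomial \<alpha> x) summable_on UNIV" if "norm x < \<epsilon>" for x :: "complex ^ 'n"
    using \<epsilon>(2)
    by (rule abs_summable_summable[OF Infinite_Sum.abs_summable_on_comparison_test'])
      (use that in \<open>auto simp: norm_mult intro!: mult_left_mono norm_monomial_le\<close>)
  with \<epsilon>(1) show ?l
    unfolding has_series_iff_summable eventually_nhds_0_norm by blast
qed

lemma germ_bounded: "\<exists>C>0. \<forall>\<^sub>F x in nhds 0. norm (rep_germ f x) \<le> C"
proof -
  obtain c where c: "has_series f c"
    using has_series_exists by blast
  then obtain \<epsilon> where \<epsilon>: "\<epsilon> > 0" "(\<lambda>\<alpha>. norm (c \<alpha>) * \<epsilon> ^ sum \<alpha> UNIV) summable_on UNIV"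
    using convergent_iff_polydisc[of c] by blast
  let ?S = "\<Sum>\<^sub>\<infinity>\<alpha>. norm (c \<alpha>) * \<epsilon> ^ sum \<alpha> UNIV"
  have "\<forall>\<^sub>F x in nhds (0 :: complex ^ 'a). norm x < \<epsilon>"
    using \<epsilon>(1) unfolding eventually_nhds_0_norm by blast
  with c[unfolded has_series_def] have "\<forall>\<^sub>F x in nhds 0. norm (rep_germ f x) \<le> ?S + 1"
  proof eventually_elim
    case (elim x)
    have le: "norm (c \<alpha> * monomial \<alpha> x) \<le> norm (c \<alpha>) * \<epsilon> ^ sum \<alpha> UNIV" for \<alpha>
      using elim(2) by (auto simp: norm_mult intro!: mult_left_mono norm_monomial_le)
    have sum: "(\<lambda>\<alpha>. norm (c \<alpha> * monomial \<alpha> x)) summable_on UNIV"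
      using \<epsilon>(2) le by (rule Infinite_Sum.abs_summable_on_comparison_test')
    have "norm (rep_germ f x) \<le> (\<Sum>\<^sub>\<infinity>\<alpha>. norm (c \<alpha> * monomial \<alpha> x))"
      using has_sum_infsum[OF sum] elim(1) by (rule norm_has_sum_bound)
    also have "\<dots> \<le> ?S"
      using sum \<epsilon>(2) le by (rule infsum_mono)
    finally have "norm (rep_germ f x) \<le> ?S" .
    then show ?case by simp
  qed
  moreover have "?S + 1 > 0"
    using \<epsilon>(1) by (intro add_nonneg_pos infsum_nonneg) auto
  ultimately show ?thesis by blast
qed

section \<open>Division by monomials\<close>

lemma has_series_restrict:
  assumes "has_series f c"
  shows "\<exists>g. has_series g (\<lambda>\<alpha>. if \<alpha> \<in> A then c \<alpha> else 0)"
proof -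
  obtain \<epsilon> where \<epsilon>: "\<epsilon> > 0" "(\<lambda>\<alpha>. norm (c \<alpha>) * \<epsilon> ^ sum \<alpha> UNIV) summable_on UNIV"
    using assms convergent_iff_polydisc[of c] by blast
  have "(\<lambda>\<alpha>. norm (if \<alpha> \<in> A then c \<alpha> else 0) * \<epsilon> ^ sum \<alpha> UNIV) summable_on UNIV"
    using \<epsilon>(2) by (rule summable_on_comparison_test) (use \<epsilon>(1) in auto)
  then show ?thesis
    using \<epsilon>(1) convergent_iff_polydisc by blast
qed

lemma has_series_split:
  assumes "has_series f c"
  obtains g h where "f = g + h" "has_series g (\<lambda>\<alpha>. if \<alpha> \<in> A then c \<alpha> else 0)"
    "has_series h (\<lambda>\<alpha>. if \<alpha> \<in> A then 0 else c \<alpha>)"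
proof -
  obtain g h where gh: "has_series g (\<lambda>\<alpha>. if \<alpha> \<in> A then c \<alpha> else 0)"
    "has_series h (\<lambda>\<alpha>. if \<alpha> \<in> - A then c \<alpha> else 0)"
    using has_series_restrict[OF assms, of A] has_series_restrict[OF assms, of "- A"] by blast
  have "(\<lambda>\<alpha>. (if \<alpha> \<in> A then c \<alpha> else 0) + (if \<alpha> \<in> - A then c \<alpha> else 0)) = c"
    by auto
  with has_series_plus[OF gh] have "has_series (g + h) c"
    by simp
  with assms have "f = g + h"
    by (rule has_series_unique)
  moreover have "(\<lambda>\<alpha>. if \<alpha> \<in> - A then c \<alpha> else 0) = (\<lambda>\<alpha>. if \<alpha> \<in> A then 0 else c \<alpha>)"
    by auto
  ultimately show ?thesis
    using gh that by simp
qed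

lemma analytic_at_0_monomial: "analytic_at_0 (monomial \<mu>)"
  unfolding analytic_at_0_def
proof (intro exI conjI allI impI)
  fix x
  show "((\<lambda>\<alpha>. (if \<alpha> = \<mu> then 1 else 0) * monomial \<alpha> x) has_sum monomial \<mu> x) UNIV"
    by (rule has_sum_finite_neutralI[where B = "{\<mu>}"]) auto
qed (rule zero_less_one)

definition mono_germ :: "('n::finite \<Rightarrow> nat) \<Rightarrow> 'n germ" where
  "mono_germ \<mu> = abs_germ (monomial \<mu>)"

lemma rep_mono_germ: "\<forall>\<^sub>F x in nhds 0. rep_germ (mono_germ \<mu>) x = monomial \<mu> x"
  unfolding mono_germ_def by (rule rep_germ_abs_germ) (rule analytic_at_0_monomial)

lemma monomial_add: "monomial (\<lambda>i. \<alpha> i + \<beta> i) x = monomial \<alpha> x * monomial \<beta> x"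
  by (simp add: monomial_def power_add prod.distrib)

text \<open>The quotient has the shifted coefficients \<open>c (\<beta> + \<mu>)\<close>. For them the sum in the polydisc
  criterion is a part of the sum for \<open>c\<close>, divided by the constant \<open>\<epsilon> ^ sum \<mu> UNIV\<close>.\<close>

lemma mono_germ_dvd:
  fixes c :: "('n::finite \<Rightarrow> nat) \<Rightarrow> complex"
  assumes c: "has_series f c" and supp: "\<And>\<alpha>. c \<alpha> \<noteq> 0 \<Longrightarrow> \<mu> \<le> \<alpha>"
  shows "mono_germ \<mu> dvd f"
proof -
  let ?s = "\<lambda>\<beta> i. \<beta> i + \<mu> i"
  let ?d = "\<lambda>\<beta>. c (?s \<beta>)"
  have inj: "inj ?s"
    by (auto simp: inj_def fun_eq_iff)
  have range: "\<alpha> \<in> range ?s" if "\<mu> \<le> \<alpha>" for \<alpha>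
    by (rule image_eqI[of _ _ "\<lambda>i. \<alpha> i - \<mu> i"]) (use that in \<open>auto simp: le_fun_def\<close>)
  obtain \<epsilon> where \<epsilon>: "\<epsilon> > 0" "(\<lambda>\<alpha>. norm (c \<alpha>) * \<epsilon> ^ sum \<alpha> UNIV) summable_on UNIV"
    using c convergent_iff_polydisc[of c] by blast
  have "(\<lambda>\<alpha>. norm (c \<alpha>) * \<epsilon> ^ sum \<alpha> UNIV) summable_on range ?s"
    using \<epsilon>(2) by (rule summable_on_subset) simp
  then have "(\<lambda>\<beta>. norm (?d \<beta>) * \<epsilon> ^ sum (?s \<beta>) UNIV) summable_on UNIV"
    by (subst (asm) summable_on_reindex[OF inj]) (simp add: o_def)
  then have "(\<lambda>\<beta>. norm (?d \<beta>) * \<epsilon> ^ sum (?s \<beta>) UNIV * inverse (\<epsilon> ^ sum \<mu> UNIV)) summable_on UNIV"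
    by (rule summable_on_cmult_left)
  also have "(\<lambda>\<beta>. norm (?d \<beta>) * \<epsilon> ^ sum (?s \<beta>) UNIV * inverse (\<epsilon> ^ sum \<mu> UNIV)) =
      (\<lambda>\<beta>. norm (?d \<beta>) * \<epsilon> ^ sum \<beta> UNIV)"
    using \<epsilon>(1) by (simp add: fun_eq_iff sum.distrib power_add)
  finally obtain g where g: "has_series g ?d"
    using \<epsilon>(1) convergent_iff_polydisc by blast
  have "\<forall>\<^sub>F x in nhds 0. rep_germ f x = rep_germ (mono_germ \<mu> * g) x"
    using c g rep_germ_times[of "mono_germ \<mu>" g] rep_mono_germ[of \<mu>] unfolding has_series_def
  proof eventually_elim
    case (elim x)
    have "((\<lambda>\<beta>. monomial \<mu> x * (?d \<beta> * monomial \<beta> x)) has_sum (monomial \<mu> x * rep_germ g x)) UNIV"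
      using elim(2) by (rule has_sum_cmult_right)
    also have "(\<lambda>\<beta>. monomial \<mu> x * (?d \<beta> * monomial \<beta> x)) = (\<lambda>\<alpha>. c \<alpha> * monomial \<alpha> x) \<circ> ?s"
      by (simp add: fun_eq_iff monomial_add)
    also have "(\<dots> has_sum (monomial \<mu> x * rep_germ g x)) UNIV \<longleftrightarrow>
        ((\<lambda>\<alpha>. c \<alpha> * monomial \<alpha> x) has_sum (monomial \<mu> x * rep_germ g x)) (range ?s)"
      using inj by (rule has_sum_reindex[symmetric])
    also have "\<dots> \<longleftrightarrow> ((\<lambda>\<alpha>. c \<alpha> * monomial \<alpha> x) has_sum (monomial \<mu> x * rep_germ g x)) UNIV"
      by (rule has_sum_cong_neutral) (use supp range in auto)
    finally have "rep_germ f x = monomial \<mu> x * rep_germ g x"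
      using has_sum_unique[OF elim(1)] by blast
    with elim(3,4) show ?case by simp
  qed
  then have "f = mono_germ \<mu> * g"
    by (rule germ_eqI)
  then show ?thesis ..
qed

text \<open>Splitting off the terms divisible by one monomial of \<open>M\<close> after the other expresses \<open>f\<close> as a
  combination of finitely many monomials. This is the only division used: for the monomials of
  degree \<open>r\<close> it describes the powers of the maximal ideal, for powers of the coordinates it gives the
  reduction to polynomials in ideals of finite colength.\<close>

lemma ideal_gen_monomials:
  assumes "finite M" "has_series f c" "\<And>\<alpha>. c \<alpha> \<noteq> 0 \<Longrightarrow> \<exists>\<mu>\<in>M. \<mu> \<le> \<alpha>"
  shows "f \<in> ideal_gen (mono_germ ` M)"
  using assms
proof (induction M arbitrary: f c rule: finite_induct)
  case empty
  then have "c = (\<lambda>_. 0)" by auto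
  with empty(1) have "\<forall>\<^sub>F x in nhds 0. rep_germ f x = 0"
    unfolding has_series_def by (auto elim!: eventually_mono dest: has_sum_unique[OF has_sum_0_simp])
  then have "f = 0"
    by (rule germ_eqI[OF eventually_elim2[OF _ rep_germ_zero]]) simp
  then show ?case by (simp add: ideal.span_zero)
next
  case (insert \<mu> M)
  obtain g h where gh: "f = g + h" "has_series g (\<lambda>\<alpha>. if \<alpha> \<in> {\<alpha>. \<mu> \<le> \<alpha>} then c \<alpha> else 0)"
    "has_series h (\<lambda>\<alpha>. if \<alpha> \<in> {\<alpha>. \<mu> \<le> \<alpha>} then 0 else c \<alpha>)"
    by (rule has_series_split[OF insert.prems(1), of "{\<alpha>. \<mu> \<le> \<alpha>}"])
  have "mono_germ \<mu> dvd g"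
    using gh(2) by (rule mono_germ_dvd) (auto split: if_splits)
  then obtain q where "g = q * mono_germ \<mu>"
    by (metis dvdE mult.commute)
  then have "g \<in> ideal_gen (mono_germ ` insert \<mu> M)"
    by (simp add: ideal.span_scale ideal.span_base)
  moreover have "h \<in> ideal_gen (mono_germ ` M)"
    using gh(3) by (rule insert.IH) (use insert.prems(2) in \<open>auto split: if_splits\<close>)
  then have "h \<in> ideal_gen (mono_germ ` insert \<mu> M)"
    using ideal.span_mono by (rule subsetD[rotated]) auto
  ultimately show ?case
    unfolding gh(1) by (rule ideal.span_add)
qed

section \<open>Growth of germs in ideals and integral closures\<close>

lemma lesssim_iff: "lesssim_at_0 a b \<longleftrightarrow> (\<exists>C>0. \<forall>\<^sub>F x in nhds 0. a x \<le> C * b x)"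
  unfolding lesssim_at_0_def eventually_nhds by blast

lemma lesssimI: "C > 0 \<Longrightarrow> \<forall>\<^sub>F x in nhds 0. a x \<le> C * b x \<Longrightarrow> lesssim_at_0 a b"
  unfolding lesssim_iff by blast

lemma lesssim_trans:
  assumes "lesssim_at_0 a b" "lesssim_at_0 b c"
  shows "lesssim_at_0 a c"
proof -
  obtain C D where C: "C > 0" "\<forall>\<^sub>F x in nhds 0. a x \<le> C * b x"
    and D: "D > 0" "\<forall>\<^sub>F x in nhds 0. b x \<le> D * c x"
    using assms unfolding lesssim_iff by blast
  from C(2) D(2) have "\<forall>\<^sub>F x in nhds 0. a x \<le> (C * D) * c x"
  proof eventually_elim
    case (elim x)
    note elim(1)
    also have "C * b x \<le> C * (D * c x)"
      using mult_left_mono[OF elim(2)] C(1) by simp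
    finally show ?case by (simp only: mult.assoc)
  qed
  then show ?thesis
    using C(1) D(1) by (intro lesssimI[of "C * D"]) simp_all
qed

abbreviation dominated :: "'n::finite germ \<Rightarrow> (complex ^ 'n \<Rightarrow> real) \<Rightarrow> bool" where
  "dominated f N \<equiv> lesssim_at_0 (\<lambda>x. norm (rep_germ f x)) N"

lemma dominated_cong:
  assumes "\<forall>\<^sub>F x in nhds 0. rep_germ f x = F x"
  shows "dominated f N \<longleftrightarrow> lesssim_at_0 (\<lambda>x. norm (F x)) N"
proof -
  have "(\<forall>\<^sub>F x in nhds 0. norm (rep_germ f x) \<le> C * N x) \<longleftrightarrow>
      (\<forall>\<^sub>F x in nhds 0. norm (F x) \<le> C * N x)" for C
    using assms by (intro eventually_subst) (auto elim: eventually_mono)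
  then show ?thesis
    unfolding lesssim_iff by simp
qed

lemma dominated_times:
  assumes f: "dominated f M" and g: "dominated g N"
  shows "dominated (f * g) (\<lambda>x. M x * N x)"
proof -
  obtain C D where C: "C > 0" "\<forall>\<^sub>F x in nhds 0. norm (rep_germ f x) \<le> C * M x"
    and D: "D > 0" "\<forall>\<^sub>F x in nhds 0. norm (rep_germ g x) \<le> D * N x"
    using f g unfolding lesssim_iff by blast
  from C(2) D(2) rep_germ_times[of f g]
  have "\<forall>\<^sub>F x in nhds 0. norm (rep_germ (f * g) x) \<le> (C * D) * (M x * N x)"
  proof eventually_elim
    case (elim x)
    have "norm (rep_germ f x) * norm (rep_germ g x) \<le> (C * M x) * (D * N x)"
      using elim(1,2) norm_ge_zero norm_ge_zero by (rule mult_mono')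
    then show ?case
      unfolding elim(3) norm_mult by (simp only: mult_ac)
  qed
  then show ?thesis
    using C(1) D(1) by (intro lesssimI[of "C * D"]) simp_all
qed

lemma dominated_plus:
  assumes N: "\<And>x. N x \<ge> 0" and f: "dominated f N" and g: "dominated g N"
  shows "dominated (f + g) N"
proof -
  obtain C D where C: "C > 0" "\<forall>\<^sub>F x in nhds 0. norm (rep_germ f x) \<le> C * N x"
    and D: "D > 0" "\<forall>\<^sub>F x in nhds 0. norm (rep_germ g x) \<le> D * N x"
    using f g unfolding lesssim_iff by blast
  from C(2) D(2) rep_germ_plus[of f g]
  have "\<forall>\<^sub>F x in nhds 0. norm (rep_germ (f + g) x) \<le> (C + D) * N x"
    by eventually_elim (simp add: distrib_right norm_triangle_mono)
  then show ?thesis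
    using C(1) D(1) by (intro lesssimI[of "C + D"]) simp_all
qed

lemma dominated_const: "dominated f (\<lambda>_. 1)"
  using germ_bounded[of f] by (simp add: lesssim_iff)

lemma dominated_zero: "(\<And>x. N x \<ge> 0) \<Longrightarrow> dominated 0 N"
  by (simp add: dominated_cong[OF rep_germ_zero] lesssimI[of 1])

text \<open>Germs are bounded near 0, so multiplying by a ring element does not affect the estimate.\<close>

lemma dominated_ideal_gen:
  assumes N: "\<And>x. N x \<ge> 0" and S: "\<And>f. f \<in> S \<Longrightarrow> dominated f N" and f: "f \<in> ideal_gen S"
  shows "dominated f N"
  using f
proof (induction rule: ideal.span_induct_alt)
  case base
  show ?case using N by (rule dominated_zero)
next
  case (step c f g)
  have "dominated (c * f) N"
    using dominated_times[OF dominated_const[of c] S[OF step(1)]] by simp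
  with N show ?case
    using step(2) by (rule dominated_plus)
qed

lemma dominated_ideal_power:
  assumes N: "\<And>x. N x \<ge> 0" and I: "\<And>f. f \<in> I \<Longrightarrow> dominated f N"
  shows "f \<in> ideal_power I r \<Longrightarrow> dominated f (\<lambda>x. N x ^ r)"
proof (induction r arbitrary: f)
  case 0
  show ?case using dominated_const[of f] by simp
next
  case (Suc r)
  have "f \<in> ideal_gen {a * b |a b. a \<in> I \<and> b \<in> ideal_power I r}"
    using Suc.prems by simp
  with _ _ show ?case
  proof (rule dominated_ideal_gen)
    show "0 \<le> N x ^ Suc r" for x
      using N by simp
    show "dominated g (\<lambda>x. N x ^ Suc r)" if "g \<in> {a * b |a b. a \<in> I \<and> b \<in> ideal_power I r}" for g
      using that dominated_times[OF I Suc.IH] by auto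
  qed
qed

text \<open>If \<open>z\<close> exceeded \<open>D * t\<close> with \<open>D = k * C + 1\<close>, then each of the \<open>k\<close> lower terms would be at most
  \<open>C / D\<close> times \<open>norm z ^ k\<close>, so together they could not cancel the leading term.\<close>

lemma norm_root_le:
  fixes z :: "'a::real_normed_field"
  assumes root: "z ^ k + (\<Sum>i=1..k. a i * z ^ (k - i)) = 0" and k: "k \<ge> 1"
    and a: "\<And>i. i \<in> {1..k} \<Longrightarrow> norm (a i) \<le> C * t ^ i" and C: "C \<ge> 1" and t: "t \<ge> 0"
  shows "norm z \<le> (k * C + 1) * t"
proof (rule ccontr)
  assume *: "\<not> norm z \<le> (k * C + 1) * t"
  define D where "D = k * C + 1"
  have D: "D \<ge> 1" "k * C < D"
    using C by (auto simp: D_def)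
  have tz: "D * t < norm z"
    using * by (simp add: D_def)
  with D t have z: "norm z > 0"
    by (meson le_less_trans mult_nonneg_nonneg order_trans zero_le_one)
  have le: "norm (a i * z ^ (k - i)) \<le> C * norm z ^ k / D" if i: "i \<in> {1..k}" for i
  proof -
    have "D * t ^ i \<le> (D * t) ^ i"
      using D(1) i t self_le_power[of D i] by (simp add: power_mult_distrib mult_right_mono)
    also have "\<dots> \<le> norm z ^ i"
      using tz D t by (intro power_mono) auto
    finally have "t ^ i \<le> norm z ^ i / D"
      using D(1) by (simp add: pos_le_divide_eq mult.commute)
    then have "norm (a i) \<le> C * (norm z ^ i / D)"
      using a[OF i] C by (meson mult_left_mono order_trans zero_le_one)
    then have "norm (a i * z ^ (k - i)) \<le> C * (norm z ^ i / D) * norm z ^ (k - i)"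
      unfolding norm_mult norm_power by (rule mult_right_mono) simp
    also have "\<dots> = C * norm z ^ k / D"
      using i by (simp flip: power_add)
    finally show ?thesis .
  qed
  have "norm z ^ k = norm (\<Sum>i=1..k. a i * z ^ (k - i))"
    using root by (metis add_eq_0_iff norm_minus_cancel norm_power)
  also have "\<dots> \<le> (\<Sum>i=1..k. C * norm z ^ k / D)"
    using le by (rule sum_norm_le)
  also have "\<dots> = (k * C) / D * norm z ^ k"
    by simp
  also have "\<dots> < 1 * norm z ^ k"
    using D z by (intro mult_strict_right_mono) auto
  finally show False by simp
qed

text \<open>At each point near 0 the value of \<open>h\<close> is a root of a polynomial whose \<open>i\<close>-th coefficient is
  bounded by a multiple of \<open>N x ^ i\<close>. This bound is homogeneous of the right degree, so the root is
  bounded by a multiple of \<open>N x\<close>.\<close>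

lemma dominated_integral_closure:
  assumes N: "\<And>x. N x \<ge> 0" and I: "\<And>f. f \<in> I \<Longrightarrow> dominated f N" and h: "h \<in> integral_closure I"
  shows "dominated h N"
proof -
  obtain k a where k: "k \<ge> 1" and a: "\<And>i. i \<in> {1..k} \<Longrightarrow> a i \<in> ideal_power I i"
    and root: "h ^ k + (\<Sum>i=1..k. a i * h ^ (k - i)) = 0"
    using h unfolding integral_closure_def by blast
  have "\<exists>C. C > 0 \<and> (\<forall>\<^sub>F x in nhds 0. norm (rep_germ (a i) x) \<le> C * N x ^ i)" if "i \<in> {1..k}" for i
    using dominated_ideal_power[OF N I a[OF that]] unfolding lesssim_iff by blast
  then obtain c where c: "\<And>i. i \<in> {1..k} \<Longrightarrow> c i > 0"
    "\<And>i. i \<in> {1..k} \<Longrightarrow> \<forall>\<^sub>F x in nhds 0. norm (rep_germ (a i) x) \<le> c i * N x ^ i"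
    by metis
  define C where "C = 1 + (\<Sum>i=1..k. c i)"
  have C: "C \<ge> 1" "c i \<le> C" if "i \<in> {1..k}" for i
  proof -
    have "(\<Sum>i=1..k. c i) \<ge> 0"
      using c(1) by (intro sum_nonneg less_imp_le)
    then show "C \<ge> 1"
      by (simp add: C_def)
    have "c i \<le> (\<Sum>i=1..k. c i)"
      using that c(1) by (intro member_le_sum) (auto simp: less_imp_le)
    then show "c i \<le> C"
      by (simp add: C_def)
  qed
  have "\<forall>\<^sub>F x in nhds 0. \<forall>i\<in>{1..k}. norm (rep_germ (a i) x) \<le> c i * N x ^ i"
    using c(2) by (intro eventually_ball_finite) auto
  moreover have "\<forall>\<^sub>F x in nhds 0. \<forall>i\<in>{1..k}. rep_germ (a i * h ^ (k - i)) x =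
      rep_germ (a i) x * rep_germ h x ^ (k - i)"
  proof (intro eventually_ball_finite ballI)
    fix i
    show "\<forall>\<^sub>F x in nhds 0. rep_germ (a i * h ^ (k - i)) x = rep_germ (a i) x * rep_germ h x ^ (k - i)"
      using rep_germ_times[of "a i" "h ^ (k - i)"] rep_germ_power[of h "k - i"]
      by eventually_elim simp
  qed simp
  ultimately have "\<forall>\<^sub>F x in nhds 0. norm (rep_germ h x) \<le> (k * C + 1) * N x"
    using rep_germ_plus[of "h ^ k" "\<Sum>i=1..k. a i * h ^ (k - i)"] rep_germ_power[of h k]
      rep_germ_sum[of "\<lambda>i. a i * h ^ (k - i)" "{1..k}"] rep_germ_zero
  proof eventually_elim
    case (elim x)
    show ?case
    proof (rule norm_root_le)
      show "rep_germ h x ^ k + (\<Sum>i=1..k. rep_germ (a i) x * rep_germ h x ^ (k - i)) = 0"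
        using elim(2-) root by simp
      show "norm (rep_germ (a i) x) \<le> C * N x ^ i" if "i \<in> {1..k}" for i
        using elim(1) that C(2)[OF that] N[of x]
        by (meson mult_right_mono order_trans zero_le_power)
    qed (use k C N in auto)
  qed
  moreover have "k * C + 1 > 0"
    using C(1)[of 1] k by (simp add: add_nonneg_pos)
  ultimately show ?thesis
    by (intro lesssimI)
qed

section \<open>Powers of the maximal ideal\<close>

definition single :: "'n \<Rightarrow> nat \<Rightarrow> 'n \<Rightarrow> nat" where
  "single i d = (\<lambda>j. if j = i then d else 0)"

lemma sum_single: "sum (single i d) UNIV = d" for i :: "'n::finite"
  by (simp add: single_def)

lemma single_le_iff: "single i d \<le> \<alpha> \<longleftrightarrow> d \<le> \<alpha> i"
  by (auto simp: single_def le_fun_def)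

lemma monomial_single: "monomial (single i d) x = x $ i ^ d"
  by (simp add: monomial_def single_def if_distrib[of "\<lambda>k. _ ^ k"] cong: if_cong)

lemma mono_germ_add: "mono_germ (\<lambda>i. \<alpha> i + \<beta> i) = mono_germ \<alpha> * mono_germ \<beta>"
  by (rule germ_eqI, use rep_mono_germ[of "\<lambda>i. \<alpha> i + \<beta> i"] rep_germ_times[of "mono_germ \<alpha>" "mono_germ \<beta>"]
      rep_mono_germ[of \<alpha>] rep_mono_germ[of \<beta>] in eventually_elim) (simp add: monomial_add)

lemma mono_germ_power: "mono_germ (single i d) = mono_germ (single i 1) ^ d"
  by (rule germ_eqI, use rep_mono_germ[of "single i d"] rep_germ_power[of "mono_germ (single i 1)" d]
      rep_mono_germ[of "single i 1"] in eventually_elim) (simp add: monomial_single)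

lemma mono_germ_single_in_max_ideal: "mono_germ (single i 1) \<in> max_ideal"
  using eventually_nhds_x_imp_x[OF rep_mono_germ[of "single i 1"]]
  by (simp add: max_ideal_def monomial_single)

lemma mono_germ_in_power: "mono_germ \<alpha> \<in> ideal_power max_ideal (sum \<alpha> UNIV)"
proof (induction "sum \<alpha> UNIV" arbitrary: \<alpha>)
  case 0
  then show ?case by simp
next
  case (Suc r)
  have "sum \<alpha> UNIV \<noteq> 0"
    using Suc(2) by linarith
  then obtain i where i: "\<alpha> i \<noteq> 0"
    using sum.neutral[of UNIV \<alpha>] by auto
  define \<beta> where "\<beta> = \<alpha>(i := \<alpha> i - 1)"
  have \<alpha>: "\<alpha> = (\<lambda>j. single i 1 j + \<beta> j)"
    using i by (auto simp: \<beta>_def single_def fun_eq_iff)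
  have sum: "sum \<alpha> UNIV = Suc (sum \<beta> UNIV)"
    by (subst \<alpha>) (simp add: sum.distrib sum_single)
  with Suc have "mono_germ \<beta> \<in> ideal_power max_ideal r"
    by simp
  moreover have "mono_germ \<alpha> = mono_germ (single i 1) * mono_germ \<beta>"
    by (subst \<alpha>) (rule mono_germ_add)
  ultimately show ?case
    using mono_germ_single_in_max_ideal sum Suc(2) by (auto intro!: ideal.span_base)
qed

lemma finite_degree: "finite {\<alpha> :: 'n::finite \<Rightarrow> nat. sum \<alpha> UNIV = r}"
proof (rule finite_subset[OF _ finite_multiindex_le])
  show "{\<alpha>. sum \<alpha> UNIV = r} \<subseteq> {\<alpha> :: 'n \<Rightarrow> nat. \<alpha> \<le> (\<lambda>_. r)}"
    by (auto simp: le_fun_def intro!: member_le_sum)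
qed

lemma exists_multiindex_le_degree:
  fixes \<alpha> :: "'n::finite \<Rightarrow> nat"
  shows "r \<le> sum \<alpha> UNIV \<Longrightarrow> \<exists>\<mu>\<le>\<alpha>. sum \<mu> UNIV = r"
proof (induction r)
  case 0
  show ?case by (intro exI[of _ "\<lambda>_. 0"]) (simp add: le_fun_def)
next
  case (Suc r)
  then obtain \<mu> where \<mu>: "\<mu> \<le> \<alpha>" "sum \<mu> UNIV = r" by auto
  with Suc.prems have "\<not> \<alpha> \<le> \<mu>"
    using sum_mono[of UNIV \<alpha> \<mu>] by (auto simp: le_fun_def)
  then obtain i where i: "\<mu> i < \<alpha> i"
    by (auto simp: le_fun_def not_le)
  have "sum (\<lambda>j. \<mu> j + single i 1 j) UNIV = Suc r"
    using \<mu>(2) by (simp add: sum.distrib sum_single)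
  moreover have "(\<lambda>j. \<mu> j + single i 1 j) \<le> \<alpha>"
    using \<mu>(1) i by (auto simp: le_fun_def single_def)
  ultimately show ?case by blast
qed

lemma is_ideal_power: "is_ideal (ideal_power I r)"
  by (cases r) (simp_all add: ideal.subspace_UNIV)

lemma series_in_power_max_ideal:
  assumes "has_series f c" "\<And>\<alpha>. c \<alpha> \<noteq> 0 \<Longrightarrow> r \<le> sum \<alpha> UNIV"
  shows "f \<in> ideal_power max_ideal r"
proof -
  have "f \<in> ideal_gen (mono_germ ` {\<alpha>. sum \<alpha> UNIV = r})"
    by (rule ideal_gen_monomials[OF finite_degree assms(1)])
      (use assms(2) exists_multiindex_le_degree in blast)
  also have "\<dots> \<subseteq> ideal_power max_ideal r"
    by (rule ideal.span_minimal) (use mono_germ_in_power is_ideal_power in auto)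
  finally show ?thesis .
qed

lemma max_ideal_dominated:
  assumes "f \<in> max_ideal"
  shows "dominated f norm"
proof -
  obtain c where c: "has_series f c"
    using has_series_exists by blast
  have "((\<lambda>\<alpha>. c \<alpha> * monomial \<alpha> 0) has_sum 0) UNIV"
    using eventually_nhds_x_imp_x[OF c[unfolded has_series_def]] assms by (simp add: max_ideal_def)
  moreover have "((\<lambda>\<alpha>. c \<alpha> * monomial \<alpha> (0 :: complex ^ 'a)) has_sum c (\<lambda>_. 0)) UNIV"
    by (rule has_sum_finite_neutralI[where B = "{\<lambda>_. 0}"]) (auto simp: monomial_def fun_eq_iff)
  ultimately have c0: "c (\<lambda>_. 0) = 0"
    by (rule has_sum_unique[symmetric])
  have "f \<in> ideal_gen (mono_germ ` range (\<lambda>i. single i 1))"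
  proof (rule ideal_gen_monomials[OF _ c])
    fix \<alpha> assume "c \<alpha> \<noteq> 0"
    with c0 have "\<alpha> \<noteq> (\<lambda>_. 0)" by auto
    then show "\<exists>\<mu>\<in>range (\<lambda>i. single i 1). \<mu> \<le> \<alpha>"
      by (auto simp: single_le_iff fun_eq_iff Suc_le_eq)
  qed simp
  with norm_ge_zero _ show ?thesis
  proof (rule dominated_ideal_gen)
    fix g :: "'a germ" assume "g \<in> mono_germ ` range (\<lambda>i. single i 1)"
    then obtain i where "g = mono_germ (single i 1)" by auto
    then show "dominated g norm"
      unfolding \<open>g = _\<close> dominated_cong[OF rep_mono_germ] lesssim_iff
      by (intro exI[of _ 1] conjI always_eventually)
        (simp_all add: monomial_single Finite_Cartesian_Product.norm_nth_le)
  qed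
qed

text \<open>Along the ray through \<open>x\<close> the estimate says that \<open>t ^ r * norm (P x)\<close> is at most a constant times
  \<open>t ^ Suc r\<close>; now let \<open>t\<close> tend to 0.\<close>

lemma homogeneous_eq_0:
  assumes P: "\<And>t x. P (t *\<^sub>R x) = of_real t ^ r * (P x :: complex)"
    and dom: "lesssim_at_0 (\<lambda>x. norm (P x)) (\<lambda>x. norm x ^ Suc r)"
  shows "\<forall>\<^sub>F x in nhds 0. P x = 0"
proof -
  obtain C e where C: "C > 0" "e > 0" "\<And>x. norm x < e \<Longrightarrow> norm (P x) \<le> C * norm x ^ Suc r"
    using dom unfolding lesssim_iff eventually_nhds_0_norm by blast
  have "P x = 0" if x: "norm x < e" for x
  proof -
    let ?K = "C * norm x ^ Suc r"
    have "norm (P x) \<le> t * ?K" if t: "0 < t" "t < 1" for t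
    proof -
      have "t * norm x < e"
        using x t mult_left_le_one_le[of "norm x" t] by simp
      then have "norm (P (t *\<^sub>R x)) \<le> C * norm (t *\<^sub>R x) ^ Suc r"
        using t by (intro C(3)) simp
      also have "\<dots> = C * (t * norm x) ^ Suc r"
        using t by simp
      also have "\<dots> = t ^ r * (t * ?K)"
        by (simp only: power_mult_distrib power_Suc mult_ac)
      finally have "t ^ r * norm (P x) \<le> t ^ r * (t * ?K)"
        using t by (simp add: P norm_mult norm_power)
      then show ?thesis
        using t by simp
    qed
    then have "\<forall>\<^sub>F t in at_right 0. norm (P x) \<le> t * ?K"
      by (auto simp: eventually_at_right_field intro!: exI[of _ 1])
    moreover have "((\<lambda>t. t * ?K) \<longlongrightarrow> 0 * ?K) (at_right 0)"
      by (intro tendsto_intros)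
    ultimately have "norm (P x) \<le> 0 * ?K"
      by (intro tendsto_lowerbound) auto
    then show ?thesis by simp
  qed
  with C(2) show ?thesis
    unfolding eventually_nhds_0_norm by blast
qed

lemma power_max_ideal_dominated:
  "f \<in> ideal_power max_ideal r \<Longrightarrow> dominated f (\<lambda>x. norm x ^ r)"
  by (rule dominated_ideal_power) (auto intro: max_ideal_dominated)

text \<open>In the induction step the terms of degree less than \<open>r\<close> are already gone. The terms of degree
  greater than \<open>r\<close> satisfy the estimate of order \<open>Suc r\<close> by themselves, hence so does the homogeneous
  part of degree \<open>r\<close>, which must then vanish as a function. Replacing its coefficients by 0 therefore
  gives another series for \<open>f\<close>.\<close>

lemma dominated_imp_series:
  "dominated f (\<lambda>x. norm x ^ r) \<Longrightarrow> \<exists>c. has_series f c \<and> (\<forall>\<alpha>. c \<alpha> \<noteq> 0 \<longrightarrow> r \<le> sum \<alpha> UNIV)"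
proof (induction r arbitrary: f)
  case 0
  then show ?case using has_series_exists by auto
next
  case (Suc r)
  have "lesssim_at_0 (\<lambda>x :: complex ^ 'a. norm x ^ Suc r) (\<lambda>x. norm x ^ r)"
  proof (rule lesssimI[of 1])
    have "\<forall>x :: complex ^ 'a. norm x < 1 \<longrightarrow> norm x ^ Suc r \<le> 1 * norm x ^ r"
      by (auto intro!: mult_left_le_one_le)
    then show "\<forall>\<^sub>F x in nhds (0 :: complex ^ 'a). norm x ^ Suc r \<le> 1 * norm x ^ r"
      unfolding eventually_nhds_0_norm using zero_less_one by blast
  qed simp
  with Suc.prems have "dominated f (\<lambda>x. norm x ^ r)"
    by (rule lesssim_trans)
  from Suc.IH[OF this] obtain c where c: "has_series f c" "\<And>\<alpha>. c \<alpha> \<noteq> 0 \<Longrightarrow> r \<le> sum \<alpha> UNIV"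
    by blast
  let ?A = "{\<alpha> :: 'a \<Rightarrow> nat. sum \<alpha> UNIV = r}"
  let ?d = "\<lambda>\<alpha>. if \<alpha> \<in> ?A then 0 else c \<alpha>"
  obtain p h where ph: "f = p + h" "has_series p (\<lambda>\<alpha>. if \<alpha> \<in> ?A then c \<alpha> else 0)"
    "has_series h ?d"
    by (rule has_series_split[OF c(1), of ?A])
  have d: "Suc r \<le> sum \<alpha> UNIV" if "?d \<alpha> \<noteq> 0" for \<alpha>
    using that c(2)[of \<alpha>] by (auto split: if_splits)
  have "dominated h (\<lambda>x. norm x ^ Suc r)"
    using series_in_power_max_ideal[OF ph(3) d] by (rule power_max_ideal_dominated)
  with Suc.prems have "dominated (f + (- 1) * h) (\<lambda>x. norm x ^ Suc r)"
    using dominated_times[OF dominated_const, of h _ "- 1"] by (intro dominated_plus) simp_all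
  then have p: "dominated p (\<lambda>x. norm x ^ Suc r)"
    by (simp add: ph(1))
  let ?P = "\<lambda>x. \<Sum>\<alpha>\<in>?A. c \<alpha> * monomial \<alpha> x"
  have P: "\<forall>\<^sub>F x in nhds 0. rep_germ p x = ?P x"
    using ph(2)[unfolded has_series_def]
  proof eventually_elim
    case (elim x)
    have "((\<lambda>\<alpha>. (if \<alpha> \<in> ?A then c \<alpha> else 0) * monomial \<alpha> x) has_sum ?P x) UNIV"
      by (rule has_sum_finite_neutralI[where B = ?A]) (auto simp: finite_degree)
    with elim show ?case
      by (rule has_sum_unique)
  qed
  have "\<forall>\<^sub>F x in nhds 0. ?P x = 0"
  proof (rule homogeneous_eq_0)
    show "lesssim_at_0 (\<lambda>x. norm (?P x)) (\<lambda>x. norm x ^ Suc r)"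
      using p by (simp only: dominated_cong[OF P])
    fix t :: real and x :: "complex ^ 'a"
    have "(t *\<^sub>R x) $ i = of_real t * x $ i" for i
      unfolding vector_scaleR_component by (rule scaleR_conv_of_real)
    then have "monomial \<alpha> (t *\<^sub>R x) = of_real t ^ sum \<alpha> UNIV * monomial \<alpha> x" for \<alpha>
      unfolding monomial_def power_sum prod.distrib[symmetric] by (simp only: power_mult_distrib)
    then have "?P (t *\<^sub>R x) = (\<Sum>\<alpha>\<in>?A. of_real t ^ r * (c \<alpha> * monomial \<alpha> x))"
      by (intro sum.cong refl) (simp only: mem_Collect_eq mult.left_commute)
    then show "?P (t *\<^sub>R x) = of_real t ^ r * ?P x"
      unfolding sum_distrib_left .
  qed
  with P have "\<forall>\<^sub>F x in nhds 0. rep_germ p x = 0"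
    by eventually_elim simp
  then have "p = 0"
    by (rule germ_eqI[OF eventually_elim2[OF _ rep_germ_zero]]) simp
  then have "f = h"
    by (simp add: ph(1))
  with ph(3) d show ?case
    by blast
qed

lemma power_max_ideal_iff: "f \<in> ideal_power max_ideal r \<longleftrightarrow> dominated f (\<lambda>x. norm x ^ r)"
  using power_max_ideal_dominated dominated_imp_series series_in_power_max_ideal by blast

section \<open>Reductions of ideals\<close>

lemma tuple_norm_nonneg: "tuple_norm fs x \<ge> 0"
  unfolding tuple_norm_def by (rule L2_set_nonneg)

lemma dominated_tuple_norm:
  assumes "f \<in> set fs"
  shows "dominated f (tuple_norm fs)"
proof -
  obtain i where i: "i < length fs" "f = fs ! i"
    using assms by (metis in_set_conv_nth)
  have "norm (rep_germ f x) \<le> 1 * tuple_norm fs x" for x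
    using member_le_L2_set[of "{..<length fs}" i "\<lambda>i. norm (rep_germ (fs ! i) x)"] i
    by (simp add: tuple_norm_def)
  then show ?thesis
    by (intro lesssimI[of 1] always_eventually) simp_all
qed

lemma tuple_norm_lesssim_iff:
  assumes N: "\<And>x. N x \<ge> 0"
  shows "lesssim_at_0 (tuple_norm fs) N \<longleftrightarrow> (\<forall>f\<in>set fs. dominated f N)"
proof
  assume "lesssim_at_0 (tuple_norm fs) N"
  then show "\<forall>f\<in>set fs. dominated f N"
    using dominated_tuple_norm lesssim_trans by blast
next
  assume *: "\<forall>f\<in>set fs. dominated f N"
  have "\<exists>C>0. \<forall>\<^sub>F x in nhds 0. norm (rep_germ (fs ! i) x) \<le> C * N x" if "i < length fs" for i
    using * that unfolding lesssim_iff by simp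
  then obtain c where c: "\<And>i. i < length fs \<Longrightarrow> c i > 0"
    "\<And>i. i < length fs \<Longrightarrow> \<forall>\<^sub>F x in nhds 0. norm (rep_germ (fs ! i) x) \<le> c i * N x"
    by metis
  let ?C = "1 + (\<Sum>i<length fs. c i)"
  have "\<forall>\<^sub>F x in nhds 0. \<forall>i\<in>{..<length fs}. norm (rep_germ (fs ! i) x) \<le> c i * N x"
    using c(2) by (intro eventually_ball_finite) auto
  then have "\<forall>\<^sub>F x in nhds 0. tuple_norm fs x \<le> ?C * N x"
  proof eventually_elim
    case (elim x)
    have "tuple_norm fs x \<le> (\<Sum>i<length fs. norm (rep_germ (fs ! i) x))"
      unfolding tuple_norm_def by (rule L2_set_le_sum) simp
    also have "\<dots> \<le> (\<Sum>i<length fs. c i * N x)"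
      using elim by (intro sum_mono) simp
    also have "\<dots> \<le> ?C * N x"
      using N[of x] by (simp add: sum_distrib_right distrib_right)
    finally show ?case .
  qed
  moreover have "?C > 0"
    using c(1) by (intro add_pos_nonneg sum_nonneg) (auto intro: less_imp_le)
  ultimately show "lesssim_at_0 (tuple_norm fs) N"
    by (intro lesssimI)
qed

lemma subset_integral_closure: "I \<subseteq> integral_closure I"
proof
  fix h assume h: "h \<in> I"
  have "h * 1 \<in> ideal_gen {a * b |a b. a \<in> I \<and> b \<in> (UNIV :: 'a set)}"
    using h by (intro ideal.span_base) blast
  then have "- h \<in> ideal_power I 1"
    by (simp add: ideal.span_neg)
  then show "h \<in> integral_closure I"
    unfolding integral_closure_def by (auto intro!: exI[of _ 1] exI[of _ "\<lambda>_. - h"])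
qed

text \<open>Since \<open>I\<close> is contained in its own integral closure, it is contained in that of the reduction,
  to which the estimate of the generators extends.\<close>

lemma dominated_reduction:
  assumes closure: "integral_closure (ideal_gen (set fs)) = integral_closure I"
    and N: "\<And>x. N x \<ge> 0" and fs: "lesssim_at_0 (tuple_norm fs) N" and f: "f \<in> I"
  shows "dominated f N"
proof -
  have "f \<in> integral_closure (ideal_gen (set fs))"
    using f subset_integral_closure closure by blast
  with N _ show ?thesis
  proof (rule dominated_integral_closure)
    fix g assume "g \<in> ideal_gen (set fs)"
    with N _ show "dominated g N"
      by (rule dominated_ideal_gen) (use fs tuple_norm_lesssim_iff N in blast)
  qed
qed

lemma ideal_power_reduction:
  assumes "ideal_gen (set fs) \<subseteq> I" "integral_closure (ideal_gen (set fs)) = integral_closure I"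
  shows "I \<subseteq> ideal_power max_ideal r \<longleftrightarrow> lesssim_at_0 (tuple_norm fs) (\<lambda>x. norm x ^ r)"
proof
  assume "I \<subseteq> ideal_power max_ideal r"
  moreover have "set fs \<subseteq> I"
    using assms(1) ideal.span_superset by blast
  ultimately show "lesssim_at_0 (tuple_norm fs) (\<lambda>x. norm x ^ r)"
    by (auto simp: tuple_norm_lesssim_iff simp flip: power_max_ideal_iff)
next
  assume "lesssim_at_0 (tuple_norm fs) (\<lambda>x. norm x ^ r)"
  then show "I \<subseteq> ideal_power max_ideal r"
    using dominated_reduction[OF assms(2)] by (auto simp: power_max_ideal_iff)
qed

lemma sim_generators_reduction:
  assumes "ideal_gen (set fs) \<subseteq> I" "integral_closure (ideal_gen (set fs)) = integral_closure I"
    and "ideal_gen (set hs) = I"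
  shows "sim_at_0 (tuple_norm hs) (tuple_norm fs)"
  unfolding sim_at_0_def
proof
  have refl: "lesssim_at_0 (tuple_norm fs) (tuple_norm fs)" for fs :: "'a germ list"
    by (rule lesssimI[of 1]) simp_all
  have "set hs \<subseteq> I"
    using assms(3) ideal.span_superset by blast
  then show "lesssim_at_0 (tuple_norm hs) (tuple_norm fs)"
    using dominated_reduction[OF assms(2) tuple_norm_nonneg refl]
    by (auto simp: tuple_norm_lesssim_iff tuple_norm_nonneg)
  have "dominated f (tuple_norm hs)" if "f \<in> set fs" for f
  proof (rule dominated_ideal_gen[OF tuple_norm_nonneg dominated_tuple_norm])
    show "f \<in> ideal_gen (set hs)"
      using that assms(1,3) ideal.span_superset by blast
  qed
  then show "lesssim_at_0 (tuple_norm fs) (tuple_norm hs)"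
    by (simp add: tuple_norm_lesssim_iff tuple_norm_nonneg)
qed

lemma lojasiewicz_tuple_cong:
  assumes "sim_at_0 (tuple_norm fs) (tuple_norm gs)"
  shows "lojasiewicz_tuple fs = lojasiewicz_tuple gs"
proof -
  have "lesssim_at_0 a (tuple_norm fs) \<longleftrightarrow> lesssim_at_0 a (tuple_norm gs)" for a
    using assms lesssim_trans unfolding sim_at_0_def by blast
  then show ?thesis
    by (simp add: lojasiewicz_tuple_def)
qed

text \<open>The generating tuple \<open>hs\<close> ensures that the definite description defining \<open>lojasiewicz\<close> denotes.\<close>

lemma lojasiewicz_reduction:
  assumes "ideal_gen (set fs) \<subseteq> I" "integral_closure (ideal_gen (set fs)) = integral_closure I"
    and "ideal_gen (set hs) = I"
  shows "lojasiewicz I = lojasiewicz_tuple fs"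
  unfolding lojasiewicz_def
proof (rule the_equality)
  show eq: "l = lojasiewicz_tuple fs" if "\<exists>hs. ideal_gen (set hs) = I \<and> l = lojasiewicz_tuple hs" for l
    using that sim_generators_reduction[OF assms(1,2)] lojasiewicz_tuple_cong by blast
  have "lojasiewicz_tuple hs = lojasiewicz_tuple fs"
    using sim_generators_reduction[OF assms] by (rule lojasiewicz_tuple_cong)
  with assms(3) show "\<exists>hs. ideal_gen (set hs) = I \<and> lojasiewicz_tuple fs = lojasiewicz_tuple hs"
    by metis
qed

section \<open>Growth under bi-Lipschitz homeomorphisms\<close>

lemma lesssim_compose:
  assumes "lesssim_at_0 a b" "filterlim \<phi> (nhds 0) (nhds 0)"
  shows "lesssim_at_0 (\<lambda>x. a (\<phi> x)) (\<lambda>x. b (\<phi> x))"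
proof -
  obtain C where C: "C > 0" "\<forall>\<^sub>F x in nhds 0. a x \<le> C * b x"
    using assms(1) unfolding lesssim_iff by blast
  show ?thesis
    using C(1) eventually_compose_filterlim[OF C(2) assms(2)] by (rule lesssimI)
qed

lemma continuous_on_imp_filterlim_nhds_0:
  fixes \<phi> :: "'a::real_normed_vector \<Rightarrow> 'b::real_normed_vector"
  assumes "continuous_on U \<phi>" "open U" "0 \<in> U" "\<phi> 0 = 0"
  shows "filterlim \<phi> (nhds 0) (nhds 0)"
proof -
  have "isCont \<phi> 0"
    using assms continuous_on_eq_continuous_at by blast
  then have "filterlim \<phi> (nhds (\<phi> 0)) (nhds 0)"
    by (simp only: isCont_def tendsto_at_iff_tendsto_nhds)
  then show ?thesis
    by (simp only: assms(4))
qed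

text \<open>Since \<open>\<phi>\<close> and its inverse fix 0, the two Lipschitz estimates at the pair \<open>x\<close>, 0 compare
  \<open>norm x\<close> with \<open>norm (\<phi> x)\<close>. The inverse \<open>\<psi>\<close> is kept to transport estimates back along \<open>\<phi>\<close>.\<close>

lemma bilipschitz_homeo_germ_norm:
  assumes "bilipschitz_homeo_germ \<phi>"
  obtains \<psi> where "filterlim \<phi> (nhds 0) (nhds 0)" "filterlim \<psi> (nhds 0) (nhds 0)"
    "\<forall>\<^sub>F y in nhds 0. \<phi> (\<psi> y) = y" "sim_at_0 norm (\<lambda>x. norm (\<phi> x))"
proof -
  obtain U V \<psi> C U' D V' where 0: "\<phi> 0 = 0"
    and U: "open U" "0 \<in> U" and V: "open V" "0 \<in> V" and hom: "homeomorphism U V \<phi> \<psi>"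
    and U': "open U'" "0 \<in> U'" "U' \<subseteq> U" "C-lipschitz_on U' \<phi>"
    and V': "open V'" "0 \<in> V'" "V' \<subseteq> V" "D-lipschitz_on V' \<psi>"
    using assms unfolding bilipschitz_homeo_germ_def by blast
  have \<psi>0: "\<psi> 0 = 0"
    using hom U(2) 0 by (metis homeomorphism_apply1)
  have \<phi>: "filterlim \<phi> (nhds 0) (nhds 0)"
    using homeomorphism_cont1[OF hom] U 0 by (rule continuous_on_imp_filterlim_nhds_0)
  have \<psi>: "filterlim \<psi> (nhds 0) (nhds 0)"
    using homeomorphism_cont2[OF hom] V \<psi>0 by (rule continuous_on_imp_filterlim_nhds_0)
  \<comment> \<open>Lipschitz constants may be 0; \<open>L + 1\<close> is positive, as \<open>lesssim_at_0\<close> requires.\<close>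
  have lip: "norm (f x) \<le> (L + 1) * norm x"
    if "L-lipschitz_on S f" "0 \<in> S" "x \<in> S" "f 0 = 0" for L S x and f :: "'a \<Rightarrow> 'a"
    using lipschitz_onD[OF that(1,3,2)] that(4) by (simp add: distrib_right add_increasing2)
  have "lesssim_at_0 (\<lambda>x. norm (\<phi> x)) norm"
  proof (rule lesssimI)
    show "C + 1 > 0"
      using lipschitz_on_nonneg[OF U'(4)] by simp
    show "\<forall>\<^sub>F x in nhds 0. norm (\<phi> x) \<le> (C + 1) * norm x"
      using eventually_nhds_in_open[OF U'(1,2)] by eventually_elim (rule lip[OF U'(4,2) _ 0])
  qed
  moreover have "lesssim_at_0 norm (\<lambda>x. norm (\<phi> x))"
  proof (rule lesssimI)
    show "D + 1 > 0"
      using lipschitz_on_nonneg[OF V'(4)] by simp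
    show "\<forall>\<^sub>F x in nhds 0. norm x \<le> (D + 1) * norm (\<phi> x)"
      using eventually_compose_filterlim[OF eventually_nhds_in_open[OF V'(1,2)] \<phi>]
        eventually_nhds_in_open[OF U]
    proof eventually_elim
      case (elim x)
      then show ?case
        using lip[OF V'(4,2) _ \<psi>0, of "\<phi> x"] homeomorphism_apply1[OF hom] by simp
    qed
  qed
  moreover have "\<forall>\<^sub>F y in nhds 0. \<phi> (\<psi> y) = y"
    using eventually_nhds_in_open[OF V] by eventually_elim (rule homeomorphism_apply2[OF hom])
  ultimately show ?thesis
    using \<phi> \<psi> that unfolding sim_at_0_def by blast
qed

lemma lesssim_power:
  assumes "lesssim_at_0 a b" "\<And>x. a x \<ge> 0"
  shows "lesssim_at_0 (\<lambda>x. a x ^ r) (\<lambda>x. b x ^ r)"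
proof -
  obtain C where C: "C > 0" "\<forall>\<^sub>F x in nhds 0. a x \<le> C * b x"
    using assms(1) unfolding lesssim_iff by blast
  from C(2) have "\<forall>\<^sub>F x in nhds 0. a x ^ r \<le> C ^ r * b x ^ r"
    by eventually_elim (simp add: power_mono assms(2) flip: power_mult_distrib)
  with C(1) show ?thesis
    by (intro lesssimI[of "C ^ r"]) simp_all
qed

lemma lesssim_powr:
  assumes "lesssim_at_0 a b" "\<And>x. a x \<ge> 0" "\<And>x. b x \<ge> 0" "\<alpha> \<ge> 0"
  shows "lesssim_at_0 (\<lambda>x. a x powr \<alpha>) (\<lambda>x. b x powr \<alpha>)"
proof -
  obtain C where C: "C > 0" "\<forall>\<^sub>F x in nhds 0. a x \<le> C * b x"
    using assms(1) unfolding lesssim_iff by blast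
  from C(2) have "\<forall>\<^sub>F x in nhds 0. a x powr \<alpha> \<le> C powr \<alpha> * b x powr \<alpha>"
  proof eventually_elim
    case (elim x)
    have "a x powr \<alpha> \<le> (C * b x) powr \<alpha>"
      using assms(4,2) elim by (rule powr_mono2)
    then show ?case
      using C(1) assms(3) by (simp add: powr_mult)
  qed
  with C(1) show ?thesis
    by (intro lesssimI[of "C powr \<alpha>"]) simp_all
qed

lemma lesssim_compose_iff:
  assumes "filterlim \<phi> (nhds 0) (nhds 0)" "filterlim \<psi> (nhds 0) (nhds 0)"
    "\<forall>\<^sub>F y in nhds 0. \<phi> (\<psi> y) = y"
  shows "lesssim_at_0 (\<lambda>x. a (\<phi> x)) (\<lambda>x. b (\<phi> x)) \<longleftrightarrow> lesssim_at_0 a b"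
proof
  assume "lesssim_at_0 (\<lambda>x. a (\<phi> x)) (\<lambda>x. b (\<phi> x))"
  then have "lesssim_at_0 (\<lambda>y. a (\<phi> (\<psi> y))) (\<lambda>y. b (\<phi> (\<psi> y)))"
    using assms(2) by (rule lesssim_compose)
  then obtain C where C: "C > 0" "\<forall>\<^sub>F y in nhds 0. a (\<phi> (\<psi> y)) \<le> C * b (\<phi> (\<psi> y))"
    unfolding lesssim_iff by blast
  from C(2) assms(3) have "\<forall>\<^sub>F y in nhds 0. a y \<le> C * b y"
    by eventually_elim simp
  with C(1) show "lesssim_at_0 a b"
    by (rule lesssimI)
qed (rule lesssim_compose[OF _ assms(1)])

lemma lesssim_sim_cong:
  assumes "sim_at_0 a a'" "sim_at_0 b b'"
  shows "lesssim_at_0 a b \<longleftrightarrow> lesssim_at_0 a' b'"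
  using assms lesssim_trans unfolding sim_at_0_def by blast

lemma bilipschitz_compare_norm:
  assumes \<phi>: "bilipschitz_homeo_germ \<phi>" and FG: "sim_at_0 F (\<lambda>x. G (\<phi> x))"
  shows "lesssim_at_0 F (\<lambda>x. norm x ^ r) \<longleftrightarrow> lesssim_at_0 G (\<lambda>x. norm x ^ r)"
    and "\<alpha> \<ge> 0 \<Longrightarrow> lesssim_at_0 (\<lambda>x. norm x powr \<alpha>) F \<longleftrightarrow> lesssim_at_0 (\<lambda>x. norm x powr \<alpha>) G"
proof -
  obtain \<psi> where \<psi>: "filterlim \<phi> (nhds 0) (nhds 0)" "filterlim \<psi> (nhds 0) (nhds 0)"
    "\<forall>\<^sub>F y in nhds 0. \<phi> (\<psi> y) = y" and norm: "sim_at_0 norm (\<lambda>x. norm (\<phi> x))"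
    using bilipschitz_homeo_germ_norm[OF \<phi>] .
  have "sim_at_0 (\<lambda>x. norm x ^ r) (\<lambda>x. norm (\<phi> x) ^ r)"
    using norm unfolding sim_at_0_def by (simp add: lesssim_power)
  then have "lesssim_at_0 F (\<lambda>x. norm x ^ r) \<longleftrightarrow> lesssim_at_0 (\<lambda>x. G (\<phi> x)) (\<lambda>x. norm (\<phi> x) ^ r)"
    by (rule lesssim_sim_cong[OF FG])
  also have "\<dots> \<longleftrightarrow> lesssim_at_0 G (\<lambda>x. norm x ^ r)"
    using \<psi> by (rule lesssim_compose_iff)
  finally show "lesssim_at_0 F (\<lambda>x. norm x ^ r) \<longleftrightarrow> lesssim_at_0 G (\<lambda>x. norm x ^ r)" .
  assume "\<alpha> \<ge> 0"
  then have "sim_at_0 (\<lambda>x. norm x powr \<alpha>) (\<lambda>x. norm (\<phi> x) powr \<alpha>)"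
    using norm unfolding sim_at_0_def by (simp add: lesssim_powr)
  then have "lesssim_at_0 (\<lambda>x. norm x powr \<alpha>) F \<longleftrightarrow>
      lesssim_at_0 (\<lambda>x. norm (\<phi> x) powr \<alpha>) (\<lambda>x. G (\<phi> x))"
    using FG by (rule lesssim_sim_cong)
  also have "\<dots> \<longleftrightarrow> lesssim_at_0 (\<lambda>x. norm x powr \<alpha>) G"
    using \<psi> by (rule lesssim_compose_iff)
  finally show "lesssim_at_0 (\<lambda>x. norm x powr \<alpha>) F \<longleftrightarrow> lesssim_at_0 (\<lambda>x. norm x powr \<alpha>) G" .
qed

section \<open>Ideals of finite colength\<close>

definition germ_poly :: "complex poly \<Rightarrow> 'n::finite germ \<Rightarrow> 'n germ" where
  "germ_poly p X = poly (map_poly const_germ p) X"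

lemma germ_poly_plus: "germ_poly (p + q) X = germ_poly p X + germ_poly q X"
proof -
  have "map_poly const_germ (p + q) = map_poly const_germ p + (map_poly const_germ q :: 'a germ poly)"
    by (rule poly_eqI) (simp add: coeff_map_poly const_germ_algebra)
  then show ?thesis by (simp add: germ_poly_def)
qed

lemma germ_poly_smult: "germ_poly (smult a p) X = const_germ a * germ_poly p X"
  by (simp add: germ_poly_def map_poly_smult const_germ_algebra)

lemma germ_poly_pCons: "germ_poly (pCons a p) X = const_germ a + X * germ_poly p X"
  by (simp add: germ_poly_def map_poly_pCons const_germ_algebra)

lemma germ_poly_monom: "germ_poly (monom a k) X = const_germ a * X ^ k"
  by (simp add: germ_poly_def map_poly_monom const_germ_algebra poly_monom)

lemma germ_poly_sum: "germ_poly (\<Sum>k\<in>A. p k) X = (\<Sum>k\<in>A. germ_poly (p k) X)"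
  by (induction A rule: infinite_finite_induct) (simp_all add: germ_poly_plus, simp_all add: germ_poly_def)

lemma germ_poly_linear_factor:
  "germ_poly ([:- a, 1:] * q) X = (X - const_germ a) * germ_poly q X"
proof -
  have "[:- a, 1:] * q = smult (- a) q + pCons 0 q"
    by simp
  then show ?thesis
    by (simp only: germ_poly_plus germ_poly_smult germ_poly_pCons const_germ_algebra)
      (simp add: left_diff_distrib)
qed

text \<open>If the finite set \<open>B\<close> spans the quotient by \<open>I\<close>, then modulo \<open>I\<close> the \<open>card B + 1\<close> powers of \<open>X\<close>
  up to \<open>card B\<close> are linearly dependent.\<close>

lemma finite_colength_polynomial:
  assumes I: "is_ideal I" and fin: "finite_colength I"
  shows "\<exists>p. p \<noteq> 0 \<and> germ_poly p X \<in> I"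
proof -
  obtain B where B: "finite B" "\<And>f. \<exists>g\<in>germ_vector_space.span B. f - g \<in> I"
    using fin unfolding finite_colength_def by blast
  have "\<forall>k. \<exists>g. g \<in> germ_vector_space.span B \<and> X ^ k - g \<in> I"
    using B(2) by blast
  then obtain g where g: "\<And>k::nat. g k \<in> germ_vector_space.span B" "\<And>k. X ^ k - g k \<in> I"
    unfolding choice_iff by blast
  let ?N = "card B"
  \<comment> \<open>Linear dependence is a notion for sets; the family \<open>g\<close> may also repeat a value, which is a
    dependence of its own.\<close>
  have "\<exists>a. (\<exists>k\<le>?N. a k \<noteq> 0) \<and> (\<Sum>k\<le>?N. const_germ (a k) * g k) = 0"
  proof (cases "inj_on g {..?N}")
    case True
    have "\<not> germ_vector_space.independent (g ` {..?N})"
    proof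
      assume "germ_vector_space.independent (g ` {..?N})"
      then have "card (g ` {..?N}) \<le> ?N"
        using g(1) by (intro conjunct2[OF germ_vector_space.independent_span_bound[OF B(1)]]) auto
      then show False
        by (simp add: card_image[OF True])
    qed
    then obtain u v where "v \<in> g ` {..?N}" "u v \<noteq> 0" "(\<Sum>v\<in>g ` {..?N}. const_germ (u v) * v) = 0"
      by (auto simp: germ_vector_space.dependent_finite)
    then show ?thesis
      by (intro exI[of _ "u \<circ> g"]) (auto simp: sum.reindex[OF True])
  next
    case False
    then obtain j k where jk: "j \<le> ?N" "k \<le> ?N" "j \<noteq> k" "g j = g k"
      by (auto simp: inj_on_def)
    let ?a = "\<lambda>i. if i = j then 1 else if i = k then - 1 else (0::complex)"
    have "(\<Sum>i\<le>?N. const_germ (?a i) * g i) = (\<Sum>i\<in>{j, k}. const_germ (?a i) * g i)"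
      using jk by (intro sum.mono_neutral_right) (auto simp: const_germ_algebra)
    also have "\<dots> = 0"
      using jk by (simp add: const_germ_algebra)
    finally show ?thesis
      using jk(1) by (intro exI[of _ ?a]) auto
  qed
  then obtain a k where a: "k \<le> ?N" "a k \<noteq> 0" "(\<Sum>k\<le>?N. const_germ (a k) * g k) = 0"
    by blast
  define p where "p = (\<Sum>k\<le>?N. monom (a k) k)"
  have "coeff p k = a k"
    using a(1) by (simp add: p_def coeff_sum)
  then have "p \<noteq> 0"
    using a(2) by auto
  moreover have "germ_poly p X = (\<Sum>k\<le>?N. const_germ (a k) * (X ^ k - g k))"
    using a(3) by (simp add: p_def germ_poly_sum germ_poly_monom right_diff_distrib sum_subtractf)
  then have "germ_poly p X \<in> I"
    using g(2) by (simp add: ideal.subspace_sum[OF I] ideal.subspace_scale[OF I])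
  ultimately show ?thesis by blast
qed

text \<open>The inverse is the geometric series in \<open>x $ i / a\<close>, times \<open>- inverse a\<close>. As a series over
  multi-indices its terms sit on the multiples of the \<open>i\<close>-th unit vector.\<close>

lemma coordinate_minus_const_unit:
  fixes i :: "'n::finite"
  assumes "a \<noteq> 0"
  shows "mono_germ (single i 1) - const_germ a dvd 1"
proof -
  let ?F = "\<lambda>x :: complex ^ 'n. inverse (x $ i - a)"
  let ?c = "\<lambda>\<alpha>. if \<alpha> \<in> range (single i) then - inverse a * inverse a ^ \<alpha> i else 0"
  have inj: "inj (single i)"
    by (auto simp: inj_def single_def fun_eq_iff)
  have sum: "((\<lambda>\<alpha>. ?c \<alpha> * monomial \<alpha> x) has_sum ?F x) UNIV" if x: "norm x < norm a" for x
  proof -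
    let ?z = "x $ i / a"
    have "norm (x $ i) < norm a"
      using Finite_Cartesian_Product.norm_nth_le[of x i] x by linarith
    then have z: "norm ?z < 1"
      using assms by (simp add: norm_divide)
    have "x $ i \<noteq> a"
      using \<open>norm (x $ i) < norm a\<close> by auto
    have "((\<lambda>k. ?z ^ k) has_sum (1 / (1 - ?z))) UNIV"
      using z by (intro norm_summable_imp_has_sum geometric_sums) (simp_all add: norm_power summable_geometric)
    then have "((\<lambda>k. - inverse a * ?z ^ k) has_sum (- inverse a * (1 / (1 - ?z)))) UNIV"
      by (rule has_sum_cmult_right)
    also have "- inverse a * (1 / (1 - ?z)) = ?F x"
      using assms \<open>x $ i \<noteq> a\<close> by (simp add: field_simps)
    also have "(\<lambda>k. - inverse a * ?z ^ k) = (\<lambda>\<alpha>. ?c \<alpha> * monomial \<alpha> x) \<circ> single i"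
      by (simp add: fun_eq_iff monomial_single field_simps) (simp add: single_def)
    also have "(\<dots> has_sum ?F x) UNIV \<longleftrightarrow> ((\<lambda>\<alpha>. ?c \<alpha> * monomial \<alpha> x) has_sum ?F x) (range (single i))"
      using inj by (rule has_sum_reindex[symmetric])
    also have "\<dots> \<longleftrightarrow> ((\<lambda>\<alpha>. ?c \<alpha> * monomial \<alpha> x) has_sum ?F x) UNIV"
      by (rule has_sum_cong_neutral) auto
    finally show ?thesis .
  qed
  then have "analytic_at_0 ?F"
    unfolding analytic_at_0_def using assms by (intro exI[of _ ?c] exI[of _ "norm a"]) simp
  then have F: "\<forall>\<^sub>F x in nhds 0. rep_germ (abs_germ ?F) x = ?F x"
    by (rule rep_germ_abs_germ)
  have near: "\<forall>\<^sub>F x in nhds (0 :: complex ^ 'n). norm x < norm a"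
    unfolding eventually_nhds_0_norm using assms by (intro exI[of _ "norm a"]) simp
  have "1 = (mono_germ (single i 1) + const_germ (- a)) * abs_germ ?F"
  proof (rule germ_eqI)
    show "\<forall>\<^sub>F x in nhds 0. rep_germ 1 x =
        rep_germ ((mono_germ (single i 1) + const_germ (- a)) * abs_germ ?F) x"
      using F near rep_germ_one rep_germ_times[of "mono_germ (single i 1) + const_germ (- a)" "abs_germ ?F"]
        rep_germ_plus[of "mono_germ (single i 1)" "const_germ (- a)"]
        rep_mono_germ[of "single i 1"] rep_germ_const[of "- a"]
    proof eventually_elim
      case (elim x)
      have "x $ i \<noteq> a"
        using Finite_Cartesian_Product.norm_nth_le[of x i] elim(2) by auto
      with elim show ?case
        by (simp add: monomial_single)
    qed
  qed
  then show ?thesis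
    by (intro dvdI[of _ _ "abs_germ ?F"]) (simp add: const_germ_algebra)
qed

text \<open>A linear factor of \<open>p\<close> with nonzero root becomes a unit and can be cancelled, and a factor with
  root 0 contributes to the power of \<open>X\<close>. The exponent \<open>e\<close> collects the latter in the induction.\<close>

lemma power_in_ideal_if_polynomial:
  fixes i :: "'n::finite"
  defines "X \<equiv> mono_germ (single i 1) :: 'n germ"
  assumes I: "is_ideal I" and "p \<noteq> 0" "X ^ e * germ_poly p X \<in> I"
  shows "\<exists>d. X ^ d \<in> I"
  using assms(3,4)
proof (induction "degree p" arbitrary: p e)
  case 0
  then obtain c where c: "p = [:c:]" "c \<noteq> 0"
    by (metis degree_eq_zeroE pCons_0_0)
  have "const_germ (inverse c) * const_germ c = (1 :: 'n germ)"
    using c(2) by (simp flip: const_germ_algebra)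
  moreover have "germ_poly p X = const_germ c"
    by (simp add: c(1) germ_poly_pCons germ_poly_def[of 0])
  ultimately have "X ^ e = const_germ (inverse c) * (X ^ e * germ_poly p X)"
    by (simp add: mult.commute[of "X ^ e"] flip: mult.assoc)
  also have "\<dots> \<in> I"
    using 0(3) by (rule ideal.subspace_scale[OF I])
  finally show ?case ..
next
  case (Suc n)
  then have "\<not> constant (poly p)"
    by (simp add: constant_degree)
  then obtain a where "poly p a = 0"
    using fundamental_theorem_of_algebra by blast
  then obtain q where q: "p = [:- a, 1:] * q"
    by (auto simp: poly_eq_0_iff_dvd)
  with Suc.prems have q0: "q \<noteq> 0" by auto
  then have deg: "n = degree q"
    using Suc(2) unfolding q by (subst (asm) degree_mult_eq) simp_all
  have factor: "germ_poly p X = (X - const_germ a) * germ_poly q X"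
    by (subst q) (rule germ_poly_linear_factor)
  have in_I: "X ^ e * ((X - const_germ a) * germ_poly q X) \<in> I"
    by (rule subst[OF factor, of "\<lambda>g. X ^ e * g \<in> I"]) (rule Suc.prems(2))
  show ?case
  proof (cases "a = 0")
    case True
    then have "X ^ Suc e * germ_poly q X = X ^ e * ((X - const_germ a) * germ_poly q X)"
      unfolding power_Suc2 mult.assoc by (simp only: const_germ_algebra diff_zero)
    then have "X ^ Suc e * germ_poly q X \<in> I"
      using in_I by (rule ssubst)
    then show ?thesis
      by (rule Suc.hyps(1)[OF deg q0])
  next
    case False
    then obtain u where u: "1 = (X - const_germ a) * u"
      using coordinate_minus_const_unit unfolding X_def by blast
    have "X ^ e * germ_poly q X = ((X - const_germ a) * u) * (X ^ e * germ_poly q X)"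
      by (simp flip: u)
    also have "\<dots> = u * (X ^ e * ((X - const_germ a) * germ_poly q X))"
      by (simp only: mult_ac)
    also have "\<dots> \<in> I"
      using in_I by (rule ideal.subspace_scale[OF I])
    finally show ?thesis
      by (rule Suc.hyps(1)[OF deg q0])
  qed
qed

lemma finite_colength_power:
  assumes "is_ideal I" "finite_colength I"
  shows "\<exists>d. mono_germ (single i d) \<in> I"
proof -
  obtain p where "p \<noteq> 0" "mono_germ (single i 1) ^ 0 * germ_poly p (mono_germ (single i 1)) \<in> I"
    using finite_colength_polynomial[OF assms] unfolding power_0 mult_1 by blast
  then obtain d where "mono_germ (single i 1) ^ d \<in> I"
    using power_in_ideal_if_polynomial[OF assms(1)] by blast
  then show ?thesis
    unfolding mono_germ_power[symmetric] ..
qed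

lemma finite_series_in_span:
  assumes p: "has_series p (\<lambda>\<alpha>. if \<alpha> \<in> F then c \<alpha> else 0)" and F: "finite F"
  shows "p \<in> germ_vector_space.span (mono_germ ` F)"
proof -
  have "\<forall>\<^sub>F x in nhds 0. \<forall>\<alpha>\<in>F. rep_germ (const_germ (c \<alpha>) * mono_germ \<alpha>) x = c \<alpha> * monomial \<alpha> x"
  proof (intro eventually_ball_finite[OF F] ballI)
    fix \<alpha>
    show "\<forall>\<^sub>F x in nhds 0. rep_germ (const_germ (c \<alpha>) * mono_germ \<alpha>) x = c \<alpha> * monomial \<alpha> x"
      using rep_germ_times[of "const_germ (c \<alpha>)" "mono_germ \<alpha>"] rep_germ_const[of "c \<alpha>"]
        rep_mono_germ[of \<alpha>] by eventually_elim simp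
  qed
  then have "\<forall>\<^sub>F x in nhds 0. rep_germ p x = rep_germ (\<Sum>\<alpha>\<in>F. const_germ (c \<alpha>) * mono_germ \<alpha>) x"
    using p[unfolded has_series_def] rep_germ_sum[of "\<lambda>\<alpha>. const_germ (c \<alpha>) * mono_germ \<alpha>" F]
  proof eventually_elim
    case (elim x)
    have "((\<lambda>\<alpha>. (if \<alpha> \<in> F then c \<alpha> else 0) * monomial \<alpha> x) has_sum (\<Sum>\<alpha>\<in>F. c \<alpha> * monomial \<alpha> x)) UNIV"
      by (rule has_sum_finite_neutralI[where B = F]) (auto simp: F)
    with elim(2) have "rep_germ p x = (\<Sum>\<alpha>\<in>F. c \<alpha> * monomial \<alpha> x)"
      by (rule has_sum_unique)
    with elim(1,3) show ?case by simp
  qed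
  then have "p = (\<Sum>\<alpha>\<in>F. const_germ (c \<alpha>) * mono_germ \<alpha>)"
    by (rule germ_eqI)
  then show ?thesis
    by (simp add: germ_vector_space.span_sum germ_vector_space.span_scale germ_vector_space.span_base)
qed

lemma is_ideal_imp_vector_subspace: "is_ideal I \<Longrightarrow> germ_vector_space.subspace I"
  by (simp add: ideal.subspace_def germ_vector_space.subspace_def)

text \<open>The generators are powers of the coordinates contained in \<open>I\<close>, together with a basis of the
  space of those polynomials in \<open>I\<close> whose degree in each coordinate is less than the respective
  exponent. Dividing an element of \<open>I\<close> by the powers leaves such a polynomial as remainder.\<close>

lemma finite_colength_imp_finitely_generated:
  fixes I :: "'n::finite germ set"
  assumes I: "is_ideal I" and fin: "finite_colength I"
  shows "\<exists>fs. ideal_gen (set fs) = I"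
proof -
  obtain d where d: "\<And>i. mono_germ (single i (d i)) \<in> I"
    using finite_colength_power[OF assms] by metis
  define F where "F = {\<alpha>. \<forall>i. \<alpha> i < d i}"
  have F: "finite F"
    by (rule finite_subset[OF _ finite_multiindex_le[of d]]) (auto simp: F_def le_fun_def less_imp_le)
  let ?V = "I \<inter> germ_vector_space.span (mono_germ ` F)"
  obtain B where B: "B \<subseteq> ?V" "germ_vector_space.independent B" "?V \<subseteq> germ_vector_space.span B"
    using germ_vector_space.maximal_independent_subset by blast
  have "finite B"
    using germ_vector_space.independent_span_bound[of "mono_germ ` F" B] F B(1,2) by auto
  let ?M = "range (\<lambda>i. single i (d i))"
  let ?S = "mono_germ ` ?M \<union> B"
  have "ideal_gen ?S \<subseteq> I"
    by (rule ideal.span_minimal[OF _ I]) (use d B(1) in auto)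
  moreover have "f \<in> ideal_gen ?S" if f: "f \<in> I" for f
  proof -
    obtain c where c: "has_series f c"
      using has_series_exists by blast
    obtain p h where ph: "f = p + h" "has_series p (\<lambda>\<alpha>. if \<alpha> \<in> F then c \<alpha> else 0)"
      "has_series h (\<lambda>\<alpha>. if \<alpha> \<in> F then 0 else c \<alpha>)"
      by (rule has_series_split[OF c, of F])
    have "h \<in> ideal_gen (mono_germ ` ?M)"
      by (rule ideal_gen_monomials[OF _ ph(3)])
        (auto simp: F_def single_le_iff not_less split: if_splits)
    then have h: "h \<in> ideal_gen ?S"
      using ideal.span_mono[of "mono_germ ` ?M" ?S] by blast
    have "p = f - h"
      by (simp add: ph(1))
    moreover have "h \<in> I"
      using h \<open>ideal_gen ?S \<subseteq> I\<close> by blast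
    ultimately have "p \<in> I"
      using f by (simp add: ideal.subspace_diff[OF I])
    then have "p \<in> germ_vector_space.span B"
      using finite_series_in_span[OF ph(2) F] B(3) by blast
    also have "\<dots> \<subseteq> ideal_gen ?S"
      by (intro germ_vector_space.span_minimal is_ideal_imp_vector_subspace ideal.subspace_span)
        (auto intro: ideal.span_base)
    finally show ?thesis
      unfolding ph(1) using h by (intro ideal.span_add)
  qed
  ultimately have "ideal_gen ?S = I"
    by blast
  moreover obtain fs where "set fs = ?S"
    using finite_list[of ?S] \<open>finite B\<close> by auto
  ultimately show ?thesis by metis
qed

section \<open>Bi-Lipschitz invariance of the order and of the Lojasiewicz exponent\<close>

theorem theorem6p2:
  fixes I J :: "'n::finite germ set"
  assumes "proper_ideal I" and "proper_ideal J"
    and "bilipschitz_equivalent I J"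
  shows "ideal_order I = ideal_order J \<and>
    (finite_colength I \<and> finite_colength J \<longrightarrow> lojasiewicz I = lojasiewicz J)"
proof (intro conjI impI)
  obtain fs gs \<phi> where
    I: "ideal_gen (set fs) \<subseteq> I" "integral_closure (ideal_gen (set fs)) = integral_closure I" and
    J: "ideal_gen (set gs) \<subseteq> J" "integral_closure (ideal_gen (set gs)) = integral_closure J" and
    \<phi>: "bilipschitz_homeo_germ \<phi>" "sim_at_0 (tuple_norm fs) (\<lambda>x. tuple_norm gs (\<phi> x))"
    using assms(3) unfolding bilipschitz_equivalent_def by blast
  have "I \<subseteq> ideal_power max_ideal r \<longleftrightarrow> J \<subseteq> ideal_power max_ideal r" for r
    unfolding ideal_power_reduction[OF I] ideal_power_reduction[OF J]
    using \<phi> by (rule bilipschitz_compare_norm)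
  then show "ideal_order I = ideal_order J"
    by (simp add: ideal_order_def)
  assume "finite_colength I \<and> finite_colength J"
  then obtain hs ks where "ideal_gen (set hs) = I" "ideal_gen (set ks) = J"
    using assms(1,2) finite_colength_imp_finitely_generated unfolding proper_ideal_def by metis
  then have "lojasiewicz I = lojasiewicz_tuple fs" "lojasiewicz J = lojasiewicz_tuple gs"
    using lojasiewicz_reduction[OF I] lojasiewicz_reduction[OF J] by blast+
  moreover have "lojasiewicz_tuple fs = lojasiewicz_tuple gs"
    unfolding lojasiewicz_tuple_def
    using bilipschitz_compare_norm(2)[OF \<phi>] by (metis (no_types, lifting))
  ultimately show "lojasiewicz I = lojasiewicz J"
    by simp
qed

end
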